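(* For every closed EML expression $\varphi$ such that $[\![\varphi]\!]$ is defined, $[\![\varphi]\!]$ is a computable complex number. In particular, $\mathrm{EML}_{\mathbb{R}}$ is contained in the set of computable real numbers.
   Context: Closed EML expressions form the smallest set $\mathcal{E}$ of strings over the alphabet $\{1, E, (, ), ,\}$ such that the string $1\in\mathcal{E}$, and if $\alpha,\beta\in\mathcal{E}$ then the string $E(\alpha,\beta)\in\mathcal{E}$. Their value $[\![\cdot]\!]$ is defined recursively by $[\![1]\!]=1$ and $[\![E(\alpha,\beta)]\!]=\exp([\![\alpha]\!])-\log([\![\beta]\!])$, where $\log$ is the principal branch of the complex natural logarithm on $\mathbb{C}\setminus\{0\}$, with imaginary part in $(-\pi,\pi]$. The value $[\![E(\alpha,\beta)]\!]$ is defined exactly when $[\![\alpha]\!]$ and $[\![\beta]\!]$ are defined and $[\![\beta]\!]\neq 0$. Let $\mathrm{EML}=\{[\![\varphi]\!]:\varphi\in\mathcal{E},\ [\![\varphi]\!]\text{ defined}\}$ and $\mathrm{EML}_{\mathbb{R}}=\mathrm{EML}\cap\mathbb{R}$. A real number $x$ is computable if there is a Turing machine which on input $k$ outputs a rational within $2^{-k}$ of $x$. A complex number is computable if its real and imaginary parts are computable. *)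

theory Defs
  imports "HOL-Analysis.Analysis"
begin

section \<open>Closed EML expressions\<close>

datatype eml_char = Sym_1 | Sym_E | Sym_LPar | Sym_RPar | Sym_Comma

definition eml_E :: "eml_char list \<Rightarrow> eml_char list \<Rightarrow> eml_char list" where
  "eml_E \<alpha> \<beta> = [Sym_E, Sym_LPar] @ \<alpha> @ [Sym_Comma] @ \<beta> @ [Sym_RPar]"

inductive_set eml_expressions :: "eml_char list set" where
  one: "[Sym_1] \<in> eml_expressions"
| E: "\<alpha> \<in> eml_expressions \<Longrightarrow> \<beta> \<in> eml_expressions \<Longrightarrow> eml_E \<alpha> \<beta> \<in> eml_expressions"

text \<open>
  The value is partial, hence introduced as a relation; it is single-valued by unique
  readability, and the recursion equations of the value function are derived below.
\<close>

inductive eml_has_value :: "eml_char list \<Rightarrow> complex \<Rightarrow> bool" where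
  one: "eml_has_value [Sym_1] 1"
| E: "eml_has_value \<alpha> a \<Longrightarrow> eml_has_value \<beta> b \<Longrightarrow> b \<noteq> 0 \<Longrightarrow>
      eml_has_value (eml_E \<alpha> \<beta>) (exp a - Ln b)"

definition eml_defined :: "eml_char list \<Rightarrow> bool" where
  "eml_defined \<phi> \<longleftrightarrow> (\<exists>v. eml_has_value \<phi> v)"

definition eml_value :: "eml_char list \<Rightarrow> complex" where
  "eml_value \<phi> = (THE v. eml_has_value \<phi> v)"

lemma eml_expressions_prefix_free:
  assumes "\<alpha> \<in> eml_expressions" "\<beta> \<in> eml_expressions" "\<alpha> @ x = \<beta> @ y"
  shows "\<alpha> = \<beta> \<and> x = y"
  using assms
proof (induction \<alpha> arbitrary: \<beta> x y rule: eml_expressions.induct)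
  case one
  then show ?case by (cases \<beta> rule: eml_expressions.cases) (auto simp: eml_E_def)
next
  case (E \<alpha>1 \<alpha>2)
  from E.prems(1) show ?case
  proof (cases rule: eml_expressions.cases)
    case one
    then show ?thesis using E.prems by (auto simp: eml_E_def)
  next
    case (E \<beta>1 \<beta>2)
    have "\<alpha>1 @ (Sym_Comma # \<alpha>2 @ Sym_RPar # x) = \<beta>1 @ (Sym_Comma # \<beta>2 @ Sym_RPar # y)"
      using E.prems(2) E(1) by (simp add: eml_E_def)
    then have 1: "\<alpha>1 = \<beta>1" and 2: "\<alpha>2 @ (Sym_RPar # x) = \<beta>2 @ (Sym_RPar # y)"
      using E.IH(1)[OF E(2)] by blast+
    show ?thesis using 1 E.IH(2)[OF E(3) 2] E(1) by simp
  qed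
qed

lemma eml_E_inject:
  assumes "\<alpha> \<in> eml_expressions" "\<alpha>' \<in> eml_expressions"
    and "eml_E \<alpha> \<beta> = eml_E \<alpha>' \<beta>'"
  shows "\<alpha> = \<alpha>' \<and> \<beta> = \<beta>'"
  using eml_expressions_prefix_free[OF assms(1,2), of "Sym_Comma # \<beta> @ [Sym_RPar]"
      "Sym_Comma # \<beta>' @ [Sym_RPar]"] assms(3)
  by (simp add: eml_E_def)

lemma eml_has_value_expression: "eml_has_value \<phi> v \<Longrightarrow> \<phi> \<in> eml_expressions"
  by (induction rule: eml_has_value.induct) (auto intro: eml_expressions.intros)

lemma eml_has_value_unique:
  "eml_has_value \<phi> v \<Longrightarrow> eml_has_value \<phi> w \<Longrightarrow> v = w"
proof (induction arbitrary: w rule: eml_has_value.induct)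
  case one
  then show ?case by (cases rule: eml_has_value.cases) (auto simp: eml_E_def)
next
  case (E \<alpha> a \<beta> b)
  from E.prems show ?case
  proof (cases rule: eml_has_value.cases)
    case one
    then show ?thesis by (auto simp: eml_E_def)
  next
    case (E \<alpha>' a' \<beta>' b')
    have "\<alpha> = \<alpha>' \<and> \<beta> = \<beta>'"
      using eml_E_inject E(1,3) E.hyps(1) eml_has_value_expression by blast
    then show ?thesis using E E.IH by auto
  qed
qed

lemma eml_value_eqI: "eml_has_value \<phi> v \<Longrightarrow> eml_value \<phi> = v"
  unfolding eml_value_def using eml_has_value_unique by blast

lemma eml_has_value_value: "eml_defined \<phi> \<Longrightarrow> eml_has_value \<phi> (eml_value \<phi>)"
  unfolding eml_defined_def using eml_value_eqI by blast

lemma eml_defined_one: "eml_defined [Sym_1]"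
  and eml_value_one: "eml_value [Sym_1] = 1"
  by (auto simp: eml_defined_def intro: eml_has_value.one eml_value_eqI)

lemma eml_defined_E:
  assumes "\<alpha> \<in> eml_expressions" "\<beta> \<in> eml_expressions"
  shows "eml_defined (eml_E \<alpha> \<beta>) \<longleftrightarrow> eml_defined \<alpha> \<and> eml_defined \<beta> \<and> eml_value \<beta> \<noteq> 0"
proof
  assume "eml_defined (eml_E \<alpha> \<beta>)"
  then obtain v where "eml_has_value (eml_E \<alpha> \<beta>) v" by (auto simp: eml_defined_def)
  then show "eml_defined \<alpha> \<and> eml_defined \<beta> \<and> eml_value \<beta> \<noteq> 0"
  proof (cases rule: eml_has_value.cases)
    case one
    then show ?thesis by (auto simp: eml_E_def)
  next
    case (E \<alpha>' a' \<beta>' b')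
    have "\<alpha> = \<alpha>' \<and> \<beta> = \<beta>'"
      using eml_E_inject E(1,3) assms(1) eml_has_value_expression by blast
    then show ?thesis using E eml_value_eqI by (auto simp: eml_defined_def)
  qed
qed (auto simp: eml_defined_def intro: eml_has_value.E eml_value_eqI dest: eml_value_eqI)

lemma eml_value_E:
  assumes "eml_defined \<alpha>" "eml_defined \<beta>" "eml_value \<beta> \<noteq> 0"
  shows "eml_value (eml_E \<alpha> \<beta>) = exp (eml_value \<alpha>) - Ln (eml_value \<beta>)"
  using assms by (intro eml_value_eqI eml_has_value.E eml_has_value_value)

definition EML :: "complex set" where
  "EML = {eml_value \<phi> | \<phi>. \<phi> \<in> eml_expressions \<and> eml_defined \<phi>}"

definition EML_real :: "real set" where
  "EML_real = {x. complex_of_real x \<in> EML}"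


section \<open>Turing machines\<close>

text \<open>
  Deterministic machines with one two-way infinite tape. States and tape symbols are natural
  numbers; each machine uses finitely many of both.
\<close>

datatype direction = Move_Left | Stay | Move_Right

fun shift :: "direction \<Rightarrow> int" where
  "shift Move_Left = - 1"
| "shift Stay = 0"
| "shift Move_Right = 1"

definition sym_blank :: nat where "sym_blank = 0"
definition sym_one :: nat where "sym_one = 1"
definition sym_minus :: nat where "sym_minus = 2"
definition sym_slash :: nat where "sym_slash = 3"

record tm =
  tm_states :: "nat set"
  tm_symbols :: "nat set"
  tm_start :: nat
  tm_halt :: nat
  tm_trans :: "nat \<Rightarrow> nat \<Rightarrow> nat \<times> nat \<times> direction"

definition turing_machine :: "tm \<Rightarrow> bool" where
  "turing_machine M \<longleftrightarrow>
     finite (tm_states M) \<and> finite (tm_symbols M) \<and>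
     tm_start M \<in> tm_states M \<and> tm_halt M \<in> tm_states M \<and>
     {sym_blank, sym_one, sym_minus, sym_slash} \<subseteq> tm_symbols M \<and>
     (\<forall>q \<in> tm_states M. \<forall>a \<in> tm_symbols M.
        tm_trans M q a \<in> tm_states M \<times> tm_symbols M \<times> UNIV)"

text \<open>A configuration consists of the current state, the tape contents and the head position.\<close>

type_synonym tm_config = "nat \<times> (int \<Rightarrow> nat) \<times> int"

fun tm_step :: "tm \<Rightarrow> tm_config \<Rightarrow> tm_config" where
  "tm_step M (q, t, h) =
     (if q = tm_halt M then (q, t, h)
      else case tm_trans M q (t h) of (q', a, d) \<Rightarrow> (q', t(h := a), h + shift d))"

definition word_tape :: "int \<Rightarrow> nat list \<Rightarrow> int \<Rightarrow> nat" where
  "word_tape p w i = (if p \<le> i \<and> i < p + int (length w) then w ! nat (i - p) else sym_blank)"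

text \<open>
  The machine starts on the first symbol of the input word \<open>u\<close>, and upon halting the tape holds
  the output word \<open>w\<close> and is blank elsewhere. For \<open>w\<close> without blanks this determines \<open>w\<close>.
\<close>

definition tm_outputs :: "tm \<Rightarrow> nat list \<Rightarrow> nat list \<Rightarrow> bool" where
  "tm_outputs M u w \<longleftrightarrow>
     (\<exists>n p h. (tm_step M ^^ n) (tm_start M, word_tape 0 u, 0) = (tm_halt M, word_tape p w, h))"

text \<open>
  Natural numbers are written in unary, a rational as a fraction of unary numerals (not
  necessarily in lowest terms) with an optional minus sign.
\<close>

definition unary :: "nat \<Rightarrow> nat list" where
  "unary n = replicate n sym_one"

definition denotes_rat :: "nat list \<Rightarrow> rat \<Rightarrow> bool" where
  "denotes_rat w r \<longleftrightarrow>
     (\<exists>m n. n > 0 \<and>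
        (w = unary m @ [sym_slash] @ unary n \<and> r = of_nat m / of_nat n \<or>
         w = [sym_minus] @ unary m @ [sym_slash] @ unary n \<and> r = - (of_nat m / of_nat n)))"


section \<open>Computable numbers\<close>

definition computable_real :: "real \<Rightarrow> bool" where
  "computable_real x \<longleftrightarrow>
     (\<exists>M. turing_machine M \<and>
        (\<forall>k. \<exists>w r. tm_outputs M (unary k) w \<and> denotes_rat w r \<and>
                   \<bar>x - real_of_rat r\<bar> \<le> 1 / 2 ^ k))"

definition computable_complex :: "complex \<Rightarrow> bool" where
  "computable_complex z \<longleftrightarrow> computable_real (Re z) \<and> computable_real (Im z)"

end

theory Submission imports Defs begin

text \<open>
  Nothing has to be uniform in the expression, so it suffices that real numbers with suitable
  rational approximations are closed under the operations occurring in \<open>exp a - Ln b\<close>; signs,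
  branches of the logarithm and lower bounds for nonzero numbers may be hard-wired into each
  machine. Hence no unbounded search is needed and all approximations can be taken primitive
  recursive. The transcendental functions reduce to power series \<open>\<Sum>n. x ^ n / v n\<close> with
  \<open>x \<ge> 0\<close> and \<open>v\<close> primitive recursive: alternating series are split into their even and odd parts,
  \<open>ln\<close> is read off from \<open>- ln (1 - x)\<close>, and \<open>pi\<close> comes from Machin's formula.

  Primitive recursive functions are computed by counter machines. A Turing machine stores
  register \<open>r\<close> in unary on a track of its own, namely as bit \<open>r\<close> of the tape symbols.
\<close>

section \<open>Counter machines and primitive recursion\<close>

text \<open>The induction over a value carries \<open>recursive_real\<close> for the real and the
  imaginary part, not \<open>computable_real\<close>: Turing machines are never composed, and the
  passage to a machine happens once, for a finished pair of numerator and denominator functions. The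
  sign of a real cannot be decided from approximations, and \<open>Ln\<close> jumps across the
  negative axis, so no single procedure turns approximations of \<open>b\<close> into approximations
  of \<open>Ln b\<close>. Every case distinction on a real is therefore made in the logic, for one
  fixed number at a time. A power series needs two estimates, one for replacing \<open>x\<close> by
  a rational and one for truncation. Both come from nonnegative terms and a point \<open>Y\<close>
  of convergence strictly beyond \<open>x\<close>: the sum is Lipschitz up to a point short of
  \<open>Y\<close>, and its tail is geometric, so that a number of terms linear in \<open>k\<close>
  suffices. Endpoints of the interval of convergence, such as \<open>arctan 1\<close>, are out of
  reach of this method.\<close>

datatype instr = Inc nat | Dec nat | Copy nat nat | JumpZ nat nat | Back nat

text \<open>
  Jumps are relative (\<open>JumpZ r d\<close> goes forward by \<open>d\<close> if register \<open>r\<close> is \<open>0\<close>, \<open>Back d\<close> always goes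
  back by \<open>d\<close>), so that code can be concatenated without relocation.
\<close>

inductive counter_step :: "instr list \<Rightarrow> nat \<times> (nat \<Rightarrow> nat) \<Rightarrow> nat \<times> (nat \<Rightarrow> nat) \<Rightarrow> bool"
  for P where
  Inc: "pc < length P \<Longrightarrow> P ! pc = Inc r \<Longrightarrow> counter_step P (pc, s) (Suc pc, s(r := Suc (s r)))"
| Dec: "pc < length P \<Longrightarrow> P ! pc = Dec r \<Longrightarrow> counter_step P (pc, s) (Suc pc, s(r := s r - 1))"
| Copy: "pc < length P \<Longrightarrow> P ! pc = Copy i j \<Longrightarrow> counter_step P (pc, s) (Suc pc, s(j := s i))"
| Jump: "pc < length P \<Longrightarrow> P ! pc = JumpZ r d \<Longrightarrow> s r = 0 \<Longrightarrow> pc + d \<le> length P \<Longrightarrow>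
    counter_step P (pc, s) (pc + d, s)"
| No_Jump: "pc < length P \<Longrightarrow> P ! pc = JumpZ r d \<Longrightarrow> s r \<noteq> 0 \<Longrightarrow>
    counter_step P (pc, s) (Suc pc, s)"
| Back: "pc < length P \<Longrightarrow> P ! pc = Back d \<Longrightarrow> counter_step P (pc, s) (pc - d, s)"

text \<open>Quantifying over the surrounding code makes position independence part of the notion.
  Termination means arriving just behind \<open>C\<close>.\<close>

definition runs :: "instr list \<Rightarrow> (nat \<Rightarrow> nat) \<Rightarrow> (nat \<Rightarrow> nat) \<Rightarrow> bool" where
  "runs C s s' \<longleftrightarrow> (\<forall>P Q. (counter_step (P @ C @ Q))\<^sup>*\<^sup>* (length P, s) (length P + length C, s'))"

lemma runs_append:
  assumes "runs C s s'" "runs D s' s''"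
  shows "runs (C @ D) s s''"
  unfolding runs_def
proof (intro allI)
  fix P Q
  have "(counter_step (P @ C @ (D @ Q)))\<^sup>*\<^sup>* (length P, s) (length P + length C, s')"
    using assms(1) unfolding runs_def by blast
  moreover have "(counter_step ((P @ C) @ D @ Q))\<^sup>*\<^sup>* (length (P @ C), s')
      (length (P @ C) + length D, s'')"
    using assms(2) unfolding runs_def by blast
  ultimately show "(counter_step (P @ (C @ D) @ Q))\<^sup>*\<^sup>* (length P, s)
      (length P + length (C @ D), s'')"
    by (auto simp: add.assoc intro: rtranclp_trans)
qed

lemma runs_Inc: "runs [Inc r] s (s(r := Suc (s r)))"
  unfolding runs_def by (auto intro!: r_into_rtranclp counter_step.Inc simp: nth_append)

lemma runs_Copy: "runs [Copy i j] s (s(j := s i))"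
  unfolding runs_def by (auto intro!: r_into_rtranclp counter_step.Copy simp: nth_append)

text \<open>The offset \<open>length B + 3\<close> leads just past the whole block, and
  \<open>length B + 2\<close> leads from its last instruction back to the test.\<close>

definition repeat_code :: "nat \<Rightarrow> instr list \<Rightarrow> instr list" where
  "repeat_code r B = JumpZ r (length B + 3) # B @ [Dec r, Back (length B + 2)]"

lemma runs_repeat_code_zero:
  assumes "s r = 0"
  shows "runs (repeat_code r B) s s"
  unfolding runs_def repeat_code_def
proof (intro allI r_into_rtranclp)
  fix P Q
  let ?R = "P @ (JumpZ r (length B + 3) # B @ [Dec r, Back (length B + 2)]) @ Q"
  have "counter_step ?R (length P, s) (length P + (length B + 3), s)"
    by (rule counter_step.Jump[where r = r]) (use assms in \<open>auto simp: nth_append\<close>)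
  then show "counter_step ?R (length P, s)
     (length P + length (JumpZ r (length B + 3) # B @ [Dec r, Back (length B + 2)]), s)"
    by (simp add: eval_nat_numeral)
qed

lemma runs_repeat_code_step:
  assumes "s r \<noteq> 0" and body: "runs B s s'"
    and rest: "runs (repeat_code r B) (s'(r := s' r - 1)) s''"
  shows "runs (repeat_code r B) s s''"
  unfolding runs_def
proof (intro allI)
  fix P Q
  let ?R = "P @ repeat_code r B @ Q"
  have 1: "counter_step ?R (length P, s) (Suc (length P), s)"
    by (rule counter_step.No_Jump[where r = r])
      (use assms in \<open>auto simp: nth_append repeat_code_def\<close>)
  have "(counter_step ((P @ [JumpZ r (length B + 3)]) @ B @ ([Dec r, Back (length B + 2)] @ Q)))\<^sup>*\<^sup>*
      (length (P @ [JumpZ r (length B + 3)]), s) (length (P @ [JumpZ r (length B + 3)]) + length B, s')"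
    using body unfolding runs_def by blast
  then have 2: "(counter_step ?R)\<^sup>*\<^sup>* (Suc (length P), s) (Suc (length P) + length B, s')"
    by (simp add: repeat_code_def)
  have 3: "counter_step ?R (Suc (length P) + length B, s')
      (Suc (Suc (length P) + length B), s'(r := s' r - 1))"
    by (rule counter_step.Dec) (auto simp: nth_append repeat_code_def)
  have "counter_step ?R (Suc (Suc (length P) + length B), s'(r := s' r - 1))
      (Suc (Suc (length P) + length B) - (length B + 2), s'(r := s' r - 1))"
    by (rule counter_step.Back) (auto simp: nth_append repeat_code_def Suc_diff_le)
  then have 4: "counter_step ?R (Suc (Suc (length P) + length B), s'(r := s' r - 1))
      (length P, s'(r := s' r - 1))"
    by simp
  have 5: "(counter_step ?R)\<^sup>*\<^sup>* (length P, s'(r := s' r - 1))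
      (length P + length (repeat_code r B), s'')"
    using rest unfolding runs_def by blast
  from 1 2 3 4 5 show "(counter_step ?R)\<^sup>*\<^sup>* (length P, s)
      (length P + length (repeat_code r B), s'')"
    by (meson converse_rtranclp_into_rtranclp rtranclp_trans)
qed

text \<open>The loop rule, by induction on the counter. The body has to leave the counter alone, and
  the invariant is demanded only after the decrement, so it may mention the counter.\<close>

lemma runs_repeat_code:
  assumes "I s"
    and "\<And>s. I s \<Longrightarrow> s r \<noteq> 0 \<Longrightarrow> \<exists>s'. runs B s s' \<and> s' r = s r \<and> I (s'(r := s r - 1))"
  shows "\<exists>s'. runs (repeat_code r B) s s' \<and> I s' \<and> s' r = 0"
  using assms(1)
proof (induction "s r" arbitrary: s)
  case 0
  then show ?case by (metis runs_repeat_code_zero)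
next
  case (Suc n)
  obtain s' where s': "runs B s s'" "s' r = s r" "I (s'(r := s r - 1))"
    using assms(2)[of s] Suc by auto
  then show ?case
    using Suc.hyps(1)[of "s'(r := s r - 1)"] Suc.hyps(2) runs_repeat_code_step[of s r B s'] by fastforce
qed

definition clear_code :: "nat \<Rightarrow> instr list" where "clear_code r = repeat_code r []"

lemma runs_Nil: "runs [] s s"
  by (simp add: runs_def)

lemma runs_clear_code: "runs (clear_code r) s (s(r := 0))"
proof -
  have "\<exists>s'. runs (clear_code r) s s' \<and> (\<forall>i. i \<noteq> r \<longrightarrow> s' i = s i) \<and> s' r = 0"
    unfolding clear_code_def by (rule runs_repeat_code) (auto intro!: exI runs_Nil)
  then obtain s' where s': "runs (clear_code r) s s'" "\<forall>i. i \<noteq> r \<longrightarrow> s' i = s i" "s' r = 0"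
    by blast
  have "s' = s(r := 0)" using s' by auto
  with s' show ?thesis by simp
qed

text \<open>
  The environment of \<open>f\<close> is read through an arbitrary assignment \<open>\<rho>\<close> of variables to registers
  below \<open>K\<close>. The code leaves the value in register \<open>K\<close>, preserves the registers below \<open>K\<close>, and may
  start and end with arbitrary contents above, which makes it usable as a subroutine.
\<close>

definition loop_computable :: "((nat \<Rightarrow> nat) \<Rightarrow> nat) \<Rightarrow> bool" where
  "loop_computable f \<longleftrightarrow> (\<forall>\<rho> K. (\<forall>i. \<rho> i < K) \<longrightarrow>
     (\<exists>C. \<forall>s. \<exists>s'. runs C s s' \<and> s' K = f (\<lambda>i. s (\<rho> i)) \<and> (\<forall>i<K. s' i = s i)))"

lemma loop_computableE:
  assumes "loop_computable f" "\<And>i. \<rho> i < K"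
  obtains C F where "\<And>s. runs C s (F s)" "\<And>s. F s K = f (\<lambda>i. s (\<rho> i))" "\<And>s i. i < K \<Longrightarrow> F s i = s i"
  using assms unfolding loop_computable_def by metis

section \<open>Compiling primitive recursion to counter programs\<close>

lemma loop_computable_var: "loop_computable (\<lambda>e. e i)"
  unfolding loop_computable_def
proof (intro allI impI)
  fix \<rho> :: "nat \<Rightarrow> nat" and K assume "\<forall>i. \<rho> i < K"
  then show "\<exists>C. \<forall>s. \<exists>s'. runs C s s' \<and> s' K = s (\<rho> i) \<and> (\<forall>i<K. s' i = s i)"
    using runs_Copy[of "\<rho> i" K] by (intro exI[of _ "[Copy (\<rho> i) K]"]) fastforce
qed

lemma loop_computable_zero: "loop_computable (\<lambda>e. 0)"
  unfolding loop_computable_def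
proof (intro allI impI)
  fix \<rho> :: "nat \<Rightarrow> nat" and K
  show "\<exists>C. \<forall>s. \<exists>s'. runs C s s' \<and> s' K = 0 \<and> (\<forall>i<K. s' i = s i)"
    using runs_clear_code[of K] by (intro exI[of _ "clear_code K"]) fastforce
qed

lemma loop_computable_Suc:
  assumes "loop_computable f"
  shows "loop_computable (\<lambda>e. Suc (f e))"
  unfolding loop_computable_def
proof (intro allI impI)
  fix \<rho> :: "nat \<Rightarrow> nat" and K assume "\<forall>i. \<rho> i < K"
  then obtain C F where C: "\<And>s. runs C s (F s)" "\<And>s. F s K = f (\<lambda>i. s (\<rho> i))"
      "\<And>s i. i < K \<Longrightarrow> F s i = s i"
    using loop_computableE[OF assms] by metis
  then have "runs (C @ [Inc K]) s ((F s)(K := Suc (F s K)))" for s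
    using runs_append runs_Inc by blast
  then show "\<exists>C. \<forall>s. \<exists>s'. runs C s s' \<and> s' K = Suc (f (\<lambda>i. s (\<rho> i))) \<and> (\<forall>i<K. s' i = s i)"
    using C by (intro exI[of _ "C @ [Inc K]"] allI exI[of _ "(F _)(K := Suc (F _ K))"] conjI) auto
qed

lemma loop_computable_reindex:
  assumes "loop_computable f"
  shows "loop_computable (\<lambda>e. f (\<lambda>i. e (\<sigma> i)))"
  unfolding loop_computable_def
proof (intro allI impI)
  fix \<rho> :: "nat \<Rightarrow> nat" and K assume "\<forall>i. \<rho> i < K"
  then have "\<forall>i. \<rho> (\<sigma> i) < K" by blast
  then show "\<exists>C. \<forall>s. \<exists>s'. runs C s s' \<and> s' K = f (\<lambda>i. s (\<rho> (\<sigma> i))) \<and> (\<forall>i<K. s' i = s i)"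
    using assms[unfolded loop_computable_def, rule_format, of "\<lambda>i. \<rho> (\<sigma> i)"] by simp
qed

lemma loop_computable_let:
  assumes "loop_computable g" "loop_computable h"
  shows "loop_computable (\<lambda>e. h (case_nat (g e) e))"
  unfolding loop_computable_def
proof (intro allI impI)
  fix \<rho> :: "nat \<Rightarrow> nat" and K assume \<rho>: "\<forall>i. \<rho> i < K"
  obtain C F where C: "\<And>s. runs C s (F s)" "\<And>s. F s K = g (\<lambda>i. s (\<rho> i))"
      "\<And>s i. i < K \<Longrightarrow> F s i = s i"
    using loop_computableE[OF assms(1)] \<rho> by metis
  have "case_nat K \<rho> i < Suc K" for i using \<rho> by (auto simp: less_Suc_eq split: nat.split)
  then obtain D G where D: "\<And>s. runs D s (G s)" "\<And>s. G s (Suc K) = h (\<lambda>i. s (case_nat K \<rho> i))"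
      "\<And>s i. i < Suc K \<Longrightarrow> G s i = s i"
    using loop_computableE[OF assms(2), of "case_nat K \<rho>" "Suc K"] by metis
  have run: "runs (C @ D @ [Copy (Suc K) K]) s ((G (F s))(K := G (F s) (Suc K)))" for s
    by (intro runs_append[OF C(1)] runs_append[OF D(1)] runs_Copy)
  have "(\<lambda>i. F s (case_nat K \<rho> i)) = case_nat (g (\<lambda>i. s (\<rho> i))) (\<lambda>i. s (\<rho> i))" for s
    using C \<rho> by (auto split: nat.split)
  then show "\<exists>C. \<forall>s. \<exists>s'. runs C s s' \<and>
      s' K = h (case_nat (g (\<lambda>i. s (\<rho> i))) (\<lambda>i. s (\<rho> i))) \<and> (\<forall>i<K. s' i = s i)"
    using C D run
    by (intro exI[of _ "C @ D @ [Copy (Suc K) K]"] allI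
        exI[of _ "(G (F _))(K := G (F _) (Suc K))"] conjI) auto
qed

lemma loop_computable_rec:
  assumes "loop_computable a" "loop_computable t"
    and "loop_computable (\<lambda>e. H (e 0) (e 1) (\<lambda>i. e (i + 2)))"
  shows "loop_computable (\<lambda>e. rec_nat (a e) (\<lambda>i r. H i r e) (t e))"
  unfolding loop_computable_def
proof (intro allI impI)
  fix \<rho> :: "nat \<Rightarrow> nat" and K assume \<rho>: "\<forall>i. \<rho> i < K"
  \<comment> \<open>Register \<open>K\<close> counts down the remaining rounds, \<open>L\<close>
    holds the index, \<open>M\<close> the accumulator, and \<open>N\<close> receives the value of
    \<open>H\<close>.\<close>
  define L M N where "L = Suc K" "M = Suc L" "N = Suc M"
  note LMN = L_M_N_def
  obtain C F where C: "\<And>s. runs C s (F s)" "\<And>s. F s K = t (\<lambda>i. s (\<rho> i))"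
      "\<And>s i. i < K \<Longrightarrow> F s i = s i"
    using loop_computableE[OF assms(2)] \<rho> by metis
  have "\<rho> i < M" for i using \<rho> LMN by (simp add: less_SucI)
  then obtain D G where D: "\<And>s. runs D s (G s)" "\<And>s. G s M = a (\<lambda>i. s (\<rho> i))"
      "\<And>s i. i < M \<Longrightarrow> G s i = s i"
    using loop_computableE[OF assms(1), of \<rho> M] by metis
  have "case_nat L (case_nat M \<rho>) i < N" for i
    using \<rho> LMN by (auto simp: less_SucI split: nat.split)
  then obtain E J where E: "\<And>s. runs E s (J s)"
      "\<And>s. J s N = H (s L) (s M) (\<lambda>i. s (\<rho> i))"
      "\<And>s i. i < N \<Longrightarrow> J s i = s i"
    using loop_computableE[OF assms(3), of "case_nat L (case_nat M \<rho>)" N] by (simp, metis)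
  let ?B = "E @ [Copy N M] @ [Inc L]"
  \<comment> \<open>\<open>L\<close> is cleared only after \<open>C\<close>, which may leave
    anything there; \<open>D\<close> works from \<open>M\<close> upwards and so keeps
    \<open>K\<close> and \<open>L\<close>.\<close>
  let ?code = "C @ clear_code L @ D @ repeat_code K ?B @ [Copy M K]"
  have "\<exists>s'. runs ?code s s' \<and>
      s' K = rec_nat (a (\<lambda>i. s (\<rho> i))) (\<lambda>i r. H i r (\<lambda>i. s (\<rho> i))) (t (\<lambda>i. s (\<rho> i))) \<and>
      (\<forall>i<K. s' i = s i)" for s
  proof -
    let ?e = "\<lambda>i. s (\<rho> i)"
    let ?R = "rec_nat (a ?e) (\<lambda>i r. H i r ?e)"
    \<comment> \<open>The bound \<open>s' K \<le> t ?e\<close> makes the truncated difference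
      \<open>t ?e - s' K\<close> the true number of finished rounds.\<close>
    define I where "I s' \<longleftrightarrow> s' K \<le> t ?e \<and> s' L = t ?e - s' K \<and> s' M = ?R (t ?e - s' K) \<and>
      (\<forall>i<K. s' i = s i)" for s'
    define s1 where "s1 = G ((F s)(L := 0))"
    have run1: "runs (C @ clear_code L @ D) s s1"
      unfolding s1_def by (intro runs_append[OF C(1)] runs_append[OF runs_clear_code] D(1))
    have "((F s)(L := 0)) (\<rho> i) = s (\<rho> i)" for i
      using C(3) \<rho> LMN by (metis fun_upd_other lessI less_asym)
    then have "I s1" using C D by (simp add: I_def s1_def LMN)
    moreover have "\<exists>s''. runs ?B s' s'' \<and> s'' K = s' K \<and> I (s''(K := s' K - 1))"
      if "I s'" "s' K \<noteq> 0" for s'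
    proof (intro exI conjI)
      let ?s'' = "((J s')(M := J s' N))(L := Suc (((J s')(M := J s' N)) L))"
      show "runs ?B s' ?s''" by (intro runs_append[OF E(1)] runs_append[OF runs_Copy] runs_Inc)
      show "?s'' K = s' K" using E by (auto simp: LMN)
      have J: "J s' L = t ?e - s' K" "J s' N = ?R (Suc (t ?e - s' K))" "\<forall>i<K. J s' i = s i"
        using that \<rho> E by (simp_all add: I_def LMN)
      moreover have "t ?e - (s' K - 1) = Suc (t ?e - s' K)" using that by (auto simp: I_def)
      ultimately show "I (?s''(K := s' K - 1))" using that(1) by (simp add: I_def LMN)
    qed
    ultimately obtain s2 where s2: "runs (repeat_code K ?B) s1 s2" "I s2" "s2 K = 0"
      using runs_repeat_code[of I s1 K ?B] by blast
    have "runs ?code s (s2(K := s2 M))"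
      using runs_append[OF run1 runs_append[OF s2(1) runs_Copy]] by simp
    then show ?thesis using s2 by (intro exI[of _ "s2(K := s2 M)"]) (auto simp: I_def)
  qed
  then show "\<exists>C. \<forall>s. \<exists>s'. runs C s s' \<and>
      s' K = rec_nat (a (\<lambda>i. s (\<rho> i))) (\<lambda>i r. H i r (\<lambda>i. s (\<rho> i))) (t (\<lambda>i. s (\<rho> i))) \<and>
      (\<forall>i<K. s' i = s i)"
    by blast
qed

lemma loop_computable_compose:
  assumes "loop_computable (\<lambda>e. f (e 0))" "loop_computable g"
  shows "loop_computable (\<lambda>e. f (g e))"
  using loop_computable_let[OF assms(2,1)] by simp

lemma loop_computable_add:
  assumes "loop_computable f" "loop_computable g"
  shows "loop_computable (\<lambda>e. f e + g e)"
proof -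
  have "loop_computable (\<lambda>e. rec_nat (f e) (\<lambda>i r. Suc r) (g e))"
    by (intro loop_computable_rec assms loop_computable_Suc loop_computable_var)
  moreover have "rec_nat x (\<lambda>i r. Suc r) n = x + n" for x n :: nat by (induction n) auto
  ultimately show ?thesis by simp
qed

lemma loop_computable_mult:
  assumes "loop_computable f" "loop_computable g"
  shows "loop_computable (\<lambda>e. f e * g e)"
proof -
  have "loop_computable (\<lambda>e. rec_nat 0 (\<lambda>i r. r + f e) (g e))"
    by (intro loop_computable_rec assms loop_computable_zero loop_computable_add
        loop_computable_var loop_computable_reindex[OF assms(1)])
  moreover have "rec_nat 0 (\<lambda>i r. r + x) n = x * n" for x n :: nat by (induction n) auto
  ultimately show ?thesis by simp
qed

lemma loop_computable_const: "loop_computable (\<lambda>e. n)"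
  by (induction n) (auto intro: loop_computable_zero loop_computable_Suc)

lemma loop_computable_power:
  assumes "loop_computable f" "loop_computable g"
  shows "loop_computable (\<lambda>e. f e ^ g e)"
proof -
  have "loop_computable (\<lambda>e. rec_nat 1 (\<lambda>i r. r * f e) (g e))"
    by (intro loop_computable_rec assms loop_computable_const loop_computable_mult
        loop_computable_var loop_computable_reindex[OF assms(1)])
  moreover have "rec_nat 1 (\<lambda>i r. r * x) n = x ^ n" for x n :: nat by (induction n) auto
  ultimately show ?thesis by simp
qed

lemma loop_computable_diff:
  assumes "loop_computable f" "loop_computable g"
  shows "loop_computable (\<lambda>e. f e - g e)"
proof -
  \<comment> \<open>Returning the index of the last round yields the predecessor.\<close>
  have "loop_computable (\<lambda>e. rec_nat 0 (\<lambda>i r. i) (e k))" for k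
    by (intro loop_computable_rec loop_computable_zero loop_computable_var)
  moreover have "rec_nat 0 (\<lambda>i r. i) n = n - 1" for n :: nat by (induction n) auto
  ultimately have pred: "loop_computable (\<lambda>e. e k - 1)" for k by simp
  have "loop_computable (\<lambda>e. rec_nat (f e) (\<lambda>i r. r - 1) (g e))"
    by (intro loop_computable_rec assms pred)
  moreover have "rec_nat x (\<lambda>i r. r - 1) n = x - n" for x n :: nat by (induction n) auto
  ultimately show ?thesis by simp
qed

lemma loop_computable_prod:
  assumes "loop_computable f" "loop_computable (\<lambda>e. v (e 0))"
  shows "loop_computable (\<lambda>e. \<Prod>i<f e. v i)"
proof -
  have "loop_computable (\<lambda>e. rec_nat 1 (\<lambda>i r. r * v i) (f e))"
    by (intro loop_computable_rec assms loop_computable_const loop_computable_mult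
        loop_computable_var)
  moreover have "rec_nat 1 (\<lambda>i r. r * v i) n = (\<Prod>i<n. v i)" for n :: nat by (induction n) auto
  ultimately show ?thesis by simp
qed

lemma loop_computable_fact:
  assumes "loop_computable f"
  shows "loop_computable (\<lambda>e. fact (f e))"
proof -
  have "loop_computable (\<lambda>e. \<Prod>i<f e. Suc i)"
    by (intro loop_computable_prod assms loop_computable_Suc loop_computable_var)
  moreover have "(\<Prod>i<n. Suc i) = fact n" for n :: nat by (induction n) auto
  ultimately show ?thesis by simp
qed

lemmas loop_computable_intros = loop_computable_var loop_computable_const loop_computable_Suc
  loop_computable_add loop_computable_mult loop_computable_diff loop_computable_power
  loop_computable_fact


section \<open>Simulation by Turing machines\<close>

text \<open>
  The symbol in cell \<open>x\<close> when register \<open>r < H\<close> occupies the cells \<open>0, \<dots>, s r - 1\<close> of track \<open>r\<close>;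
  track \<open>H\<close> marks the home cell \<open>0\<close>.
\<close>

definition cell :: "nat \<Rightarrow> (nat \<Rightarrow> nat) \<Rightarrow> int \<Rightarrow> nat" where
  "cell H s x = horner_sum of_bool 2
     (map (\<lambda>r. if r = H then x = 0 else 0 \<le> x \<and> x < int (s r)) [0..<Suc H])"

text \<open>Later tape identities are checked bit by bit through this fact; the Horner sum is not
  unfolded again.\<close>

lemma bit_cell:
  "bit (cell H s x) r \<longleftrightarrow> r < H \<and> 0 \<le> x \<and> x < int (s r) \<or> r = H \<and> x = 0"
  unfolding cell_def bit_horner_sum_bit_iff by (auto simp: less_Suc_eq simp del: upt_Suc)

lemma cell_eq_0_iff: "cell H s x = 0 \<longleftrightarrow> x \<noteq> 0 \<and> (x < 0 \<or> (\<forall>r<H. int (s r) \<le> x))"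
proof -
  have "cell H s x = 0 \<longleftrightarrow> (\<forall>r. \<not> bit (cell H s x) r)"
    unfolding bit_eq_iff[of "cell H s x"] by simp
  also have "\<dots> \<longleftrightarrow> \<not> (x = 0 \<or> (\<exists>r<H. 0 \<le> x \<and> x < int (s r)))" unfolding bit_cell by blast
  finally show ?thesis by (meson not_less)
qed

text \<open>Together with its counterpart for \<open>unset_bit\<close>, this keeps the finite
  alphabet closed under making and erasing marks.\<close>

lemma set_bit_nat_less: "set_bit r a < (2::nat) ^ n" if "a < 2 ^ n" "r < n"
proof -
  have "take_bit n (set_bit r a) = set_bit r a"
    using that by (metis not_less take_bit_nat_eq_self take_bit_set_bit_eq)
  then show ?thesis by (metis take_bit_nat_less_exp)
qed

lemma unset_bit_nat_less: "unset_bit r a < (2::nat) ^ n" if "a < 2 ^ n"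
proof -
  have "unset_bit r a \<le> a" using unset_bit_less_eq[of r "int a"] by (metis of_nat_le_iff of_nat_unset_bit_eq)
  with that show ?thesis by simp
qed

section \<open>Runs and sweeps of a Turing machine\<close>

definition reaches :: "tm \<Rightarrow> tm_config \<Rightarrow> tm_config \<Rightarrow> bool" where
  "reaches M c c' \<longleftrightarrow> (\<exists>n. (tm_step M ^^ n) c = c')"

lemma reaches_refl: "reaches M c c"
  unfolding reaches_def by (rule exI[of _ 0]) simp

lemma reaches_step: "tm_step M c = c' \<Longrightarrow> reaches M c c'"
  unfolding reaches_def by (rule exI[of _ 1]) simp

lemma reaches_trans [trans]: "reaches M c c' \<Longrightarrow> reaches M c' c'' \<Longrightarrow> reaches M c c''"
  unfolding reaches_def by (metis comp_apply funpow_add)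

text \<open>The pattern of every pass to the right: finding the end of a register
  (\<open>f = id\<close>), copying a track, and writing the output.\<close>

lemma reaches_sweep_right:
  assumes "q \<noteq> tm_halt M"
    and "\<And>x. h \<le> x \<Longrightarrow> x < h + int n \<Longrightarrow> tm_trans M q (t x) = (q, f (t x), Move_Right)"
  shows "reaches M (q, t, h) (q, \<lambda>x. if h \<le> x \<and> x < h + int n then f (t x) else t x, h + int n)"
  using assms(2)
proof (induction n)
  case (Suc n)
  let ?t = "\<lambda>x. if h \<le> x \<and> x < h + int n then f (t x) else t x"
  let ?t' = "\<lambda>x. if h \<le> x \<and> x < h + int (Suc n) then f (t x) else t x"
  have "reaches M (q, t, h) (q, ?t, h + int n)" using Suc by simp
  moreover have "?t(h + int n := f (t (h + int n))) = ?t'" by auto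
  then have "tm_step M (q, ?t, h + int n) = (q, ?t', h + int (Suc n))"
    using assms(1) Suc.prems by simp
  then have "reaches M (q, ?t, h + int n) (q, ?t', h + int (Suc n))" by (rule reaches_step)
  ultimately show ?case by (rule reaches_trans)
next
  case 0
  have "(\<lambda>x. if h \<le> x \<and> x < h + int 0 then f (t x) else t x) = t" by auto
  then show ?case by (simp add: reaches_refl)
qed

lemma reaches_sweep_left:
  assumes "q \<noteq> tm_halt M"
    and "\<And>x. h < x \<Longrightarrow> x \<le> h + int n \<Longrightarrow> tm_trans M q (t x) = (q, t x, Move_Left)"
  shows "reaches M (q, t, h + int n) (q, t, h)"
  using assms(2)
proof (induction n)
  case (Suc n)
  then have "reaches M (q, t, h + int n) (q, t, h)" by simp
  moreover have "reaches M (q, t, h + int (Suc n)) (q, t, h + int n)"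
    using assms(1) Suc.prems by (intro reaches_step) auto
  ultimately show ?case by (rule reaches_trans[rotated])
qed (simp add: reaches_refl)

fun instr_regs :: "instr \<Rightarrow> nat set" where
  "instr_regs (Inc r) = {r}"
| "instr_regs (Dec r) = {r}"
| "instr_regs (Copy i j) = {i, j}"
| "instr_regs (JumpZ r d) = {r}"
| "instr_regs (Back d) = {}"

lemma finite_instr_regs: "finite (instr_regs I)"
  by (cases I) auto

text \<open>\<open>4 \<le> H\<close> places the input register \<open>0\<close> and the output
  registers \<open>1\<close>, \<open>2\<close>, \<open>3\<close> below the home track, and
  \<open>regs\<close> keeps the program away from that track. \<open>neg\<close> is the advice on
  the sign.\<close>

locale counter_simulation =
  fixes H :: nat and neg :: bool and P :: "instr list"
  assumes H: "4 \<le> H" and regs: "\<And>I. I \<in> set P \<Longrightarrow> instr_regs I \<subseteq> {..<H}"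
begin

text \<open>
  State \<open>4 * pc + ph\<close> executes instruction \<open>pc\<close>; phase \<open>0\<close> begins at the home cell, phase \<open>1\<close> returns
  there, phase \<open>2\<close> erases the last mark of a register. With \<open>L = length P\<close>, state \<open>4 * L + 2\<close> marks
  the home cell of the input, \<open>4 * L\<close> writes the output and \<open>4 * L + 1\<close> halts.
\<close>

fun instr_trans :: "nat \<Rightarrow> instr \<Rightarrow> nat \<Rightarrow> nat \<Rightarrow> nat \<times> nat \<times> direction" where
  "instr_trans pc (Inc r) ph a =
     (if bit a r then (4 * pc, a, Move_Right) else (4 * pc + 1, set_bit r a, Stay))"
| "instr_trans pc (Dec r) ph a =
     (if ph = 2 then (4 * pc + 1, unset_bit r a, Stay)
      else if bit a r then (4 * pc, a, Move_Right)
      else if bit a H then (4 * Suc pc, a, Stay)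
      else (4 * pc + 2, a, Move_Left))"
| "instr_trans pc (Copy i j) ph a =
     (if a = 0 then (4 * pc + 1, a, Move_Left)
      else (4 * pc, if bit a i then set_bit j a else unset_bit j a, Move_Right))"
| "instr_trans pc (JumpZ r d) ph a =
     (4 * (if bit a r then Suc pc else min (pc + d) (length P)), a, Stay)"
| "instr_trans pc (Back d) ph a = (4 * (pc - d), a, Stay)"

text \<open>
  If registers \<open>1, 2, 3\<close> contain \<open>m\<close>, \<open>m + 1\<close>, \<open>m + 1 + n\<close> (each increased by \<open>1\<close> when there is a
  minus sign), then replacing every symbol by this function of it produces the numeral of \<open>m / n\<close>.
\<close>

definition output_symbol :: "nat \<Rightarrow> nat" where
  "output_symbol a =
     (if neg \<and> bit a H then sym_minus else if bit a 1 then sym_one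
      else if bit a 2 then sym_slash else if bit a 3 then sym_one else sym_blank)"

definition trans :: "nat \<Rightarrow> nat \<Rightarrow> nat \<times> nat \<times> direction" where
  "trans q a =
     (let pc = q div 4; ph = q mod 4
      in if pc < length P then
           if ph = 1 then if bit a H then (4 * Suc pc, a, Stay) else (q, a, Move_Left)
           else instr_trans pc (P ! pc) ph a
         else if ph = 0 then
           if a = 0 then (4 * length P + 1, a, Stay) else (q, output_symbol a, Move_Right)
         else (0, set_bit H a, Stay))"

definition machine :: tm where
  "machine = \<lparr>tm_states = {..<4 * length P + 4}, tm_symbols = {..<2 ^ Suc H},
     tm_start = 4 * length P + 2, tm_halt = 4 * length P + 1, tm_trans = trans\<rparr>"

lemma four_neq: "4 * i \<noteq> Suc (4 * j)" "Suc (4 * i) \<noteq> 4 * j" for i j :: nat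
  by presburger+

lemma machine_sel:
  "tm_start machine = 4 * length P + 2" "tm_halt machine = 4 * length P + 1"
  "tm_trans machine = trans"
  by (simp_all add: machine_def)

lemma trans_simps:
  assumes "pc < length P"
  shows "trans (4 * pc) a = instr_trans pc (P ! pc) 0 a"
    and "trans (Suc (4 * pc)) a =
      (if bit a H then (4 * Suc pc, a, Stay) else (Suc (4 * pc), a, Move_Left))"
    and "trans (Suc (Suc (4 * pc))) a = instr_trans pc (P ! pc) 2 a"
proof -
  have "Suc (4 * pc) div 4 = pc" "Suc (4 * pc) mod 4 = 1"
    "Suc (Suc (4 * pc)) div 4 = pc" "Suc (Suc (4 * pc)) mod 4 = 2" by presburger+
  then show "trans (4 * pc) a = instr_trans pc (P ! pc) 0 a"
    and "trans (Suc (4 * pc)) a =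
      (if bit a H then (4 * Suc pc, a, Stay) else (Suc (4 * pc), a, Move_Left))"
    and "trans (Suc (Suc (4 * pc))) a = instr_trans pc (P ! pc) 2 a"
    using assms by (simp_all add: trans_def Let_def)
qed

lemma reg_less: "pc < length P \<Longrightarrow> r \<in> instr_regs (P ! pc) \<Longrightarrow> r < H"
  using regs nth_mem by blast

lemma sym_less: "sym_blank < 2 ^ Suc H" "sym_one < 2 ^ Suc H" "sym_minus < 2 ^ Suc H"
  "sym_slash < 2 ^ Suc H"
proof -
  have "(2::nat) ^ 2 \<le> 2 ^ Suc H" using H by (intro power_increasing) auto
  then show "sym_blank < 2 ^ Suc H" "sym_one < 2 ^ Suc H" "sym_minus < 2 ^ Suc H"
    "sym_slash < 2 ^ Suc H"
    by (auto simp: sym_blank_def sym_one_def sym_minus_def sym_slash_def)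
qed

text \<open>The \<open>min\<close> in the jump case serves this bound; the simulation does not see
  it, because \<open>counter_step\<close> permits only jumps up to the end of the program.\<close>

lemma instr_trans_closed:
  assumes "pc < length P" "a < 2 ^ Suc H"
  shows "instr_trans pc (P ! pc) ph a \<in> {..<4 * length P + 4} \<times> {..<2 ^ Suc H} \<times> UNIV"
proof -
  have "set_bit r a < 2 ^ Suc H" if "r \<in> instr_regs (P ! pc)" for r
    using set_bit_nat_less[OF assms(2), of r] reg_less[OF assms(1) that] by simp
  moreover have "unset_bit r a < 2 ^ Suc H" for r
    using unset_bit_nat_less assms by blast
  moreover have "4 * min x (length P) < 4 * length P + 4" for x by simp
  ultimately show ?thesis using assms by (cases "P ! pc") (auto simp del: power_Suc)
qed

lemma turing_machine_machine: "turing_machine machine"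
proof -
  have "trans q a \<in> {..<4 * length P + 4} \<times> {..<2 ^ Suc H} \<times> UNIV"
    if "q < 4 * length P + 4" "a < 2 ^ Suc H" for q a
    using instr_trans_closed[of "q div 4" a "q mod 4"] that set_bit_nat_less[of a "Suc H" H] sym_less
    by (auto simp: trans_def Let_def output_symbol_def simp del: power_Suc)
  then show ?thesis
    using sym_less by (auto simp: turing_machine_def machine_def simp del: power_Suc)
qed

section \<open>Each counter instruction as a run of the machine\<close>

lemma reaches_home:
  assumes "pc < length P" "0 \<le> h"
  shows "reaches machine (Suc (4 * pc), cell H s, h) (4 * Suc pc, cell H s, 0)"
proof -
  have "reaches machine (Suc (4 * pc), cell H s, 0 + int (nat h)) (Suc (4 * pc), cell H s, 0)"
    using assms(1) by (intro reaches_sweep_left) (auto simp: machine_sel four_neq trans_simps bit_cell)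
  also have "reaches machine (Suc (4 * pc), cell H s, 0) (4 * Suc pc, cell H s, 0)"
    using assms(1) by (intro reaches_step) (auto simp: machine_sel four_neq trans_simps bit_cell)
  finally show ?thesis using assms by simp
qed

lemma reaches_register_end:
  assumes "pc < length P" "P ! pc = Inc r \<or> P ! pc = Dec r"
  shows "reaches machine (4 * pc, cell H s, 0) (4 * pc, cell H s, int (s r))"
proof -
  have "r < H" using reg_less[OF assms(1)] assms(2) by auto
  then have "reaches machine (4 * pc, cell H s, 0) (4 * pc,
      \<lambda>x. if 0 \<le> x \<and> x < 0 + int (s r) then id (cell H s x) else cell H s x, 0 + int (s r))"
    using assms by (intro reaches_sweep_right) (auto simp: machine_sel four_neq trans_simps bit_cell)
  then show ?thesis by (simp add: if_distrib cong: if_cong)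
qed

lemma reaches_Inc:
  assumes "pc < length P" "P ! pc = Inc r"
  shows "reaches machine (4 * pc, cell H s, 0) (4 * Suc pc, cell H (s(r := Suc (s r))), 0)"
proof -
  have r: "r < H" using reg_less[OF assms(1)] assms(2) by auto
  let ?h = "int (s r)"
  have t: "(cell H s)(?h := set_bit r (cell H s ?h)) = cell H (s(r := Suc (s r)))"
    using r by (intro ext bit_eqI) (auto simp: bit_cell bit_set_bit_iff split: if_splits)
  have "reaches machine (4 * pc, cell H s, 0) (4 * pc, cell H s, ?h)"
    using reaches_register_end assms by blast
  also have "reaches machine (4 * pc, cell H s, ?h)
      (Suc (4 * pc), cell H (s(r := Suc (s r))), ?h)"
    unfolding t[symmetric] using assms r
    by (intro reaches_step) (auto simp: machine_sel four_neq trans_simps bit_cell)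
  also have "reaches machine (Suc (4 * pc), cell H (s(r := Suc (s r))), ?h)
      (4 * Suc pc, cell H (s(r := Suc (s r))), 0)"
    using assms by (intro reaches_home) auto
  finally show ?thesis .
qed

text \<open>The head walks to the first unmarked cell of track \<open>r\<close>. Meeting the home
  mark there means that the register is \<open>0\<close>; otherwise the last mark lies one cell to
  the left and is erased in phase \<open>2\<close>.\<close>

lemma reaches_Dec:
  assumes "pc < length P" "P ! pc = Dec r"
  shows "reaches machine (4 * pc, cell H s, 0) (4 * Suc pc, cell H (s(r := s r - 1)), 0)"
proof -
  have r: "r < H" using reg_less[OF assms(1)] assms(2) by auto
  let ?h = "int (s r)"
  have 1: "reaches machine (4 * pc, cell H s, 0) (4 * pc, cell H s, ?h)"
    using reaches_register_end assms by blast
  show ?thesis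
  proof (cases "s r = 0")
    case True
    then have "s(r := s r - 1) = s" by auto
    moreover have "reaches machine (4 * pc, cell H s, 0) (4 * Suc pc, cell H s, 0)"
      using assms r True
      by (intro reaches_step) (auto simp: machine_sel four_neq trans_simps bit_cell)
    ultimately show ?thesis by simp
  next
    case False
    let ?s = "s(r := s r - 1)"
    have t: "(cell H s)(?h - 1 := unset_bit r (cell H s (?h - 1))) = cell H ?s"
      using r False by (intro ext bit_eqI) (auto simp: bit_cell bit_unset_bit_iff split: if_splits)
    note 1
    also have "reaches machine (4 * pc, cell H s, ?h) (Suc (Suc (4 * pc)), cell H s, ?h - 1)"
      using assms r False
      by (intro reaches_step) (auto simp: machine_sel four_neq trans_simps bit_cell)
    also have "reaches machine (Suc (Suc (4 * pc)), cell H s, ?h - 1) (Suc (4 * pc), cell H ?s, ?h - 1)"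
      unfolding t[symmetric] using assms
      by (intro reaches_step) (auto simp: machine_sel four_neq trans_simps)
    also have "reaches machine (Suc (4 * pc), cell H ?s, ?h - 1) (4 * Suc pc, cell H ?s, 0)"
      using assms False by (intro reaches_home) auto
    finally show ?thesis .
  qed
qed

text \<open>All tracks start at cell \<open>0\<close>, so the nonzero cells form one interval, of
  length at least \<open>1\<close> because of the home mark. Its right end is where the passes for
  \<open>Copy\<close> and for the output stop.\<close>

lemma cell_extent:
  obtains N where "0 < N" "\<And>x. cell H s x = 0 \<longleftrightarrow> x < 0 \<or> int N \<le> x"
proof
  let ?N = "Max (insert 1 (s ` {..<H}))"
  show "0 < ?N" by (auto simp: Max_gr_iff)
  have "int ?N \<le> x \<longleftrightarrow> 1 \<le> x \<and> (\<forall>r<H. int (s r) \<le> x)" if "0 \<le> x" for x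
  proof -
    have "int ?N \<le> x \<longleftrightarrow> ?N \<le> nat x" using that by linarith
    also have "\<dots> \<longleftrightarrow> 1 \<le> nat x \<and> (\<forall>r<H. s r \<le> nat x)" by (subst Max_le_iff) auto
    also have "\<dots> \<longleftrightarrow> 1 \<le> x \<and> (\<forall>r<H. int (s r) \<le> x)" using that by (auto simp: le_nat_iff)
    finally show ?thesis .
  qed
  then show "cell H s x = 0 \<longleftrightarrow> x < 0 \<or> int ?N \<le> x" for x
    by (cases "0 \<le> x") (auto simp: cell_eq_0_iff)
qed

text \<open>A single pass suffices since the tracks are aligned. It runs to the first zero symbol
  and not just to the end of track \<open>i\<close>, because the old contents of \<open>j\<close>
  may be longer.\<close>

lemma reaches_Copy:
  assumes "pc < length P" "P ! pc = Copy i j"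
  shows "reaches machine (4 * pc, cell H s, 0) (4 * Suc pc, cell H (s(j := s i)), 0)"
proof -
  have r: "i < H" "j < H" using reg_less[OF assms(1)] assms(2) by auto
  obtain N where N: "0 < N" "\<And>x. cell H s x = 0 \<longleftrightarrow> x < 0 \<or> int N \<le> x"
    using cell_extent by blast
  let ?f = "\<lambda>a. if bit a i then set_bit j a else unset_bit j a"
  let ?s = "s(j := s i)"
  let ?t = "\<lambda>x. if 0 \<le> x \<and> x < 0 + int N then ?f (cell H s x) else cell H s x"
  have big: "s r \<le> N" if "r < H" for r using N(2)[of "int N"] N(1) that by (simp add: cell_eq_0_iff)
  have t: "?t = cell H ?s"
  proof (intro ext bit_eqI)
    fix x n
    show "bit (?t x) n = bit (cell H ?s x) n"
      using r big[of i] big[of j]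
      by (auto simp: bit_cell bit_set_bit_iff bit_unset_bit_iff)
  qed
  have "reaches machine (4 * pc, cell H s, 0) (4 * pc, ?t, 0 + int N)"
    using assms N by (intro reaches_sweep_right) (auto simp: machine_sel four_neq trans_simps)
  then have "reaches machine (4 * pc, cell H s, 0) (4 * pc, cell H ?s, int N)" unfolding t by simp
  also have "reaches machine (4 * pc, cell H ?s, int N) (Suc (4 * pc), cell H ?s, int N - 1)"
  proof -
    have "cell H ?s (int N) = 0" using N(2)[of "int N"] fun_cong[OF t, of "int N"] by simp
    then show ?thesis using assms
      by (intro reaches_step) (auto simp: machine_sel four_neq trans_simps)
  qed
  also have "reaches machine (Suc (4 * pc), cell H ?s, int N - 1) (4 * Suc pc, cell H ?s, 0)"
    using assms N by (intro reaches_home) auto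
  finally show ?thesis .
qed

lemma reaches_counter_step:
  assumes "counter_step P (pc, s) (pc', s')"
  shows "reaches machine (4 * pc, cell H s, 0) (4 * pc', cell H s', 0)"
  using assms
proof (cases rule: counter_step.cases)
  case (Jump r d)
  then show ?thesis using reg_less[of pc r]
    by (intro reaches_step) (auto simp: machine_sel four_neq trans_simps bit_cell)
next
  case (No_Jump r d)
  then show ?thesis using reg_less[of pc r]
    by (intro reaches_step) (auto simp: machine_sel four_neq trans_simps bit_cell)
next
  case (Back d)
  then show ?thesis
    by (intro reaches_step) (auto simp: machine_sel four_neq trans_simps)
qed (simp_all only: prod.inject reaches_Inc reaches_Dec reaches_Copy)

lemma reaches_counter_steps:
  assumes "(counter_step P)\<^sup>*\<^sup>* c c'"
  shows "reaches machine (4 * fst c, cell H (snd c), 0) (4 * fst c', cell H (snd c'), 0)"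
  using assms
proof (induction rule: rtranclp_induct)
  case (step y z)
  then show ?case
    using reaches_counter_step[of "fst y" "snd y" "fst z" "snd z"] by (auto intro: reaches_trans)
qed (rule reaches_refl)

section \<open>Input, output and assembly of the machine\<close>

lemma reaches_start:
  "reaches machine (tm_start machine, word_tape 0 (unary k), 0)
     (0, cell H (\<lambda>r. if r = 0 then k else 0), 0)"
proof -
  \<comment> \<open>\<open>sym_one\<close> is the number \<open>1\<close>, whose only bit is bit
    \<open>0\<close>: the unary input already is track \<open>0\<close>, and only the home mark is
    missing.\<close>
  have t: "(word_tape 0 (unary k))(0 := set_bit H (word_tape 0 (unary k) 0)) =
      cell H (\<lambda>r. if r = 0 then k else 0)"
    using H by (intro ext bit_eqI)
      (auto simp: bit_cell bit_set_bit_iff word_tape_def unary_def sym_one_def sym_blank_def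
        bit_Suc_0_iff split: if_splits)
  have "(4 * length P + 2) div 4 = length P" "(4 * length P + 2) mod 4 = 2" by presburger+
  then have "trans (4 * length P + 2) a = (0, set_bit H a, Stay)" for a
    by (simp add: trans_def Let_def)
  then show ?thesis
    unfolding t[symmetric] by (intro reaches_step) (auto simp: machine_sel four_neq)
qed

text \<open>Tracks \<open>1\<close>, \<open>2\<close>, \<open>3\<close> are nested, so the first of
  them that marks a cell tells its segment. The sign overrides the home cell, hence the extra cell
  in \<open>s 1\<close>.\<close>

lemma reaches_output:
  assumes "s 1 = (if neg then 1 else 0) + m" "s 2 = s 1 + 1" "s 3 = s 2 + n"
  shows "\<exists>h. reaches machine (4 * length P, cell H s, 0)
    (tm_halt machine,
     word_tape 0 ((if neg then [sym_minus] else []) @ unary m @ [sym_slash] @ unary n), h)"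
proof -
  obtain N where N: "0 < N" "\<And>x. cell H s x = 0 \<longleftrightarrow> x < 0 \<or> int N \<le> x"
    using cell_extent by blast
  let ?w = "(if neg then [sym_minus] else []) @ unary m @ [sym_slash] @ unary n"
  let ?t = "\<lambda>x. if 0 \<le> x \<and> x < 0 + int N then output_symbol (cell H s x) else cell H s x"
  have halt_trans: "trans (4 * length P) a =
      (if a = 0 then (4 * length P + 1, a, Stay) else (4 * length P, output_symbol a, Move_Right))" for a
    by (simp add: trans_def Let_def)
  have len: "length ?w = s 3" using assms by (simp add: unary_def)
  have t: "?t x = word_tape 0 ?w x" for x
  proof (cases "0 \<le> x")
    case True
    then obtain i where i: "x = int i" using nonneg_int_cases by blast
    \<comment> \<open>Cells beyond the sweep fit too, since \<open>output_symbol\<close> sends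
      \<open>0\<close> to the blank; longer working registers are wiped.\<close>
    have "?t x = output_symbol (cell H s x)"
    proof (cases "x < int N")
      case False
      then have "cell H s x = 0" using N(2) by simp
      then show ?thesis using False by (simp add: output_symbol_def sym_blank_def)
    qed (use True in simp)
    also have "\<dots> = (if i < s 3 then ?w ! i else sym_blank)"
      using assms H i by (auto simp: output_symbol_def bit_cell nth_append unary_def nth_Cons')
    finally show ?thesis using len i by (simp add: word_tape_def)
  next
    case False
    then show ?thesis using N(2)[of x] by (auto simp: word_tape_def sym_blank_def)
  qed
  then have t: "?t = word_tape 0 ?w" ..
  have "reaches machine (4 * length P, cell H s, 0) (4 * length P, ?t, 0 + int N)"
    using N by (intro reaches_sweep_right) (auto simp: machine_sel halt_trans)
  also have "reaches machine (4 * length P, ?t, 0 + int N) (tm_halt machine, ?t, 0 + int N)"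
    using N by (intro reaches_step) (auto simp: machine_sel four_neq halt_trans fun_eq_iff)
  finally show ?thesis unfolding t by blast
qed

end

lemma turing_machine_of_loop_computable:
  assumes "loop_computable (\<lambda>e. p (e 0))" "loop_computable (\<lambda>e. q (e 0))"
  shows "\<exists>M. turing_machine M \<and>
    (\<forall>k. tm_outputs M (unary k)
      ((if neg then [sym_minus] else []) @ unary (p k) @ [sym_slash] @ unary (q k)))"
proof -
  \<comment> \<open>These are the register contents that \<open>reaches_output\<close> expects. Each
    is computed afresh from register \<open>0\<close>, with bases \<open>1\<close>,
    \<open>2\<close>, \<open>3\<close>, so that a later piece of code preserves the earlier
    results.\<close>
  define f1 where "f1 = (\<lambda>k. (if neg then 1 else 0) + p k)"
  define f2 where "f2 = (\<lambda>k. f1 k + 1)"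
  define f3 where "f3 = (\<lambda>k. f2 k + q k)"
  have f1: "loop_computable (\<lambda>e. f1 (e 0))"
    unfolding f1_def by (intro loop_computable_intros assms)
  have f2: "loop_computable (\<lambda>e. f2 (e 0))"
    unfolding f2_def by (intro loop_computable_intros f1)
  have f3: "loop_computable (\<lambda>e. f3 (e 0))"
    unfolding f3_def by (intro loop_computable_intros f2 assms)
  obtain C1 F1 where C1: "\<And>s. runs C1 s (F1 s)" "\<And>s. F1 s 1 = f1 (s 0)"
      "\<And>s i. i < 1 \<Longrightarrow> F1 s i = s i"
    using loop_computableE[OF f1, of "\<lambda>_. 0" 1] by auto
  obtain C2 F2 where C2: "\<And>s. runs C2 s (F2 s)" "\<And>s. F2 s 2 = f2 (s 0)"
      "\<And>s i. i < 2 \<Longrightarrow> F2 s i = s i"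
    using loop_computableE[OF f2, of "\<lambda>_. 0" 2] by auto
  obtain C3 F3 where C3: "\<And>s. runs C3 s (F3 s)" "\<And>s. F3 s 3 = f3 (s 0)"
      "\<And>s i. i < 3 \<Longrightarrow> F3 s i = s i"
    using loop_computableE[OF f3, of "\<lambda>_. 0" 3] by auto
  define P where "P = C1 @ C2 @ C3"
  \<comment> \<open>Inserting \<open>3\<close> guarantees \<open>4 \<le> H\<close>.\<close>
  define H where "H = Suc (Max (insert 3 (\<Union>I\<in>set P. instr_regs I)))"
  have fin: "finite (insert 3 (\<Union>I\<in>set P. instr_regs I))" by (simp add: finite_instr_regs)
  have "3 < H" unfolding H_def using Max_ge[OF fin, of 3] by (simp add: le_imp_less_Suc)
  moreover have "instr_regs I \<subseteq> {..<H}" if "I \<in> set P" for I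
    unfolding H_def using Max_ge[OF fin] that by (auto intro!: le_imp_less_Suc)
  ultimately interpret counter_simulation H neg P by unfold_locales auto
  have "tm_outputs machine (unary k)
      ((if neg then [sym_minus] else []) @ unary (p k) @ [sym_slash] @ unary (q k))" for k
  proof -
    let ?s = "\<lambda>r::nat. if r = 0 then k else 0"
    let ?s' = "F3 (F2 (F1 ?s))"
    have "runs P ?s ?s'" unfolding P_def by (intro runs_append[OF C1(1)] runs_append[OF C2(1)] C3(1))
    then have "(counter_step P)\<^sup>*\<^sup>* (0, ?s) (length P, ?s')"
      by (auto simp: runs_def dest!: spec[of _ "[]"])
    then have 1: "reaches machine (0, cell H ?s, 0) (4 * length P, cell H ?s', 0)"
      using reaches_counter_steps[of "(0, ?s)" "(length P, ?s')"] by simp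
    have "?s' 1 = f1 k" "?s' 2 = f2 k" "?s' 3 = f3 k" using C1 C2 C3 by auto
    then obtain h where 2: "reaches machine (4 * length P, cell H ?s', 0) (tm_halt machine,
        word_tape 0 ((if neg then [sym_minus] else []) @ unary (p k) @ [sym_slash] @ unary (q k)), h)"
      using reaches_output[of ?s' "p k" "q k"] by (auto simp: f1_def f2_def f3_def)
    show ?thesis
      using reaches_trans[OF reaches_trans[OF reaches_start[of k] 1] 2]
      unfolding tm_outputs_def reaches_def by blast
  qed
  then show ?thesis using turing_machine_machine by blast
qed


section \<open>Arithmetic of recursive real numbers\<close>

text \<open>
  Approximating \<open>\<bar>x\<bar>\<close> keeps all computations within the natural numbers; the sign of \<open>x\<close> is one bit
  of advice for the machine.
\<close>

definition recursive_real :: "real \<Rightarrow> bool" where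
  "recursive_real x \<longleftrightarrow> (\<exists>p q c. loop_computable (\<lambda>e. p (e 0)) \<and> loop_computable (\<lambda>e. q (e 0)) \<and>
     (\<forall>k. 0 < q k \<and> \<bar>\<bar>x\<bar> - real (p k) / real (q k)\<bar> \<le> c / 2 ^ k))"

lemma recursive_realI:
  assumes "loop_computable (\<lambda>e. p (e 0))" "loop_computable (\<lambda>e. q (e 0))" "0 \<le> x"
    and "\<And>k. 0 < q k" "\<And>k. \<bar>x - real (p k) / real (q k)\<bar> \<le> c / 2 ^ k"
  shows "recursive_real x"
  unfolding recursive_real_def using assms by (intro exI[of _ p] exI[of _ q] exI[of _ c]) auto

text \<open>Querying the approximation at \<open>k + (i + j)\<close> with \<open>c < 2 ^ i\<close>
  absorbs the constant. Closure proofs can therefore produce any \<open>c\<close> and still consume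
  any accuracy.\<close>

lemma recursive_realE:
  assumes "recursive_real x"
  obtains p q where "loop_computable (\<lambda>e. p (e 0))" "loop_computable (\<lambda>e. q (e 0))"
    "\<And>k. 0 < q k" "\<And>k. \<bar>\<bar>x\<bar> - real (p k) / real (q k)\<bar> \<le> 1 / 2 ^ (k + j)"
proof -
  obtain p q c where pq: "loop_computable (\<lambda>e. p (e 0))" "loop_computable (\<lambda>e. q (e 0))"
    "\<And>k. 0 < q k" "\<And>k. \<bar>\<bar>x\<bar> - real (p k) / real (q k)\<bar> \<le> c / 2 ^ k"
    using assms unfolding recursive_real_def by blast
  obtain i where i: "c < 2 ^ i" using real_arch_pow[of 2 c] by auto
  show ?thesis
  proof
    show "loop_computable (\<lambda>e. p (e 0 + (i + j)))" "loop_computable (\<lambda>e. q (e 0 + (i + j)))"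
      by (intro loop_computable_compose[OF pq(1)] loop_computable_compose[OF pq(2)]
          loop_computable_intros)+
    show "0 < q (k + (i + j))" for k using pq by blast
    show "\<bar>\<bar>x\<bar> - real (p (k + (i + j))) / real (q (k + (i + j)))\<bar> \<le> 1 / 2 ^ (k + j)" for k
    proof -
      have "c / 2 ^ (k + (i + j)) \<le> 2 ^ i / 2 ^ (k + (i + j))"
        using i by (intro divide_right_mono) auto
      also have "\<dots> = 1 / 2 ^ (k + j)" by (simp add: power_add)
      finally show ?thesis using pq(4)[of "k + (i + j)"] by linarith
    qed
  qed
qed

lemma recursive_real_imp_computable_real:
  assumes "recursive_real x"
  shows "computable_real x"
proof -
  obtain p q where pq: "loop_computable (\<lambda>e. p (e 0))" "loop_computable (\<lambda>e. q (e 0))"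
    "\<And>k. 0 < q k" "\<And>k. \<bar>\<bar>x\<bar> - real (p k) / real (q k)\<bar> \<le> 1 / 2 ^ (k + 0)"
    using recursive_realE[OF assms] by blast
  define w where "w k = (if x < 0 then [sym_minus] else []) @ unary (p k) @ [sym_slash] @ unary (q k)" for k
  define r :: "nat \<Rightarrow> rat" where "r k = (if x < 0 then - 1 else 1) * (of_nat (p k) / of_nat (q k))" for k
  have "denotes_rat (w k) (r k)" for k
    unfolding denotes_rat_def w_def r_def using pq(3)[of k]
    by (intro exI[of _ "p k"] exI[of _ "q k"]) auto
  moreover have "\<bar>x - real_of_rat (r k)\<bar> \<le> 1 / 2 ^ k" for k
    using pq(4)[of k]
    by (cases "x < 0") (auto simp: r_def of_rat_mult of_rat_divide of_rat_minus abs_le_iff)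
  moreover obtain M where "turing_machine M" "\<And>k. tm_outputs M (unary k) (w k)"
    using turing_machine_of_loop_computable[OF pq(1,2), of "x < 0"] unfolding w_def by blast
  ultimately show ?thesis unfolding computable_real_def by blast
qed

lemma recursive_real_abs_iff: "recursive_real \<bar>x\<bar> \<longleftrightarrow> recursive_real x"
  by (simp add: recursive_real_def)

lemma recursive_real_minus_iff: "recursive_real (- x) \<longleftrightarrow> recursive_real x"
  by (simp add: recursive_real_def)

lemma recursive_real_of_nat: "recursive_real (of_nat n)"
  by (rule recursive_realI[where p = "\<lambda>_. n" and q = "\<lambda>_. 1" and c = 0])
    (auto intro: loop_computable_const)

lemma recursive_real_numeral: "recursive_real (numeral n)"
  using recursive_real_of_nat[of "numeral n"] by simp

lemma recursive_real_one: "recursive_real 1"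
  using recursive_real_of_nat[of 1] by simp

lemma recursive_real_add_nonneg:
  assumes "recursive_real x" "recursive_real y" "0 \<le> x" "0 \<le> y"
  shows "recursive_real (x + y)"
proof -
  obtain p q where pq: "loop_computable (\<lambda>e. p (e 0))" "loop_computable (\<lambda>e. q (e 0))"
    "\<And>k. 0 < q k" "\<And>k. \<bar>\<bar>x\<bar> - real (p k) / real (q k)\<bar> \<le> 1 / 2 ^ (k + 0)"
    using recursive_realE[OF assms(1)] by blast
  obtain p' q' where pq': "loop_computable (\<lambda>e. p' (e 0))" "loop_computable (\<lambda>e. q' (e 0))"
    "\<And>k. 0 < q' k" "\<And>k. \<bar>\<bar>y\<bar> - real (p' k) / real (q' k)\<bar> \<le> 1 / 2 ^ (k + 0)"
    using recursive_realE[OF assms(2)] by blast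
  show ?thesis
  proof (rule recursive_realI[where c = 2])
    show "loop_computable (\<lambda>e. p (e 0) * q' (e 0) + p' (e 0) * q (e 0))"
      "loop_computable (\<lambda>e. q (e 0) * q' (e 0))"
      by (intro loop_computable_intros pq pq')+
    show "0 < q k * q' k" for k using pq pq' by simp
    show "\<bar>x + y - real (p k * q' k + p' k * q k) / real (q k * q' k)\<bar> \<le> 2 / 2 ^ k" for k
    proof -
      have "real (p k * q' k + p' k * q k) / real (q k * q' k) =
          real (p k) / real (q k) + real (p' k) / real (q' k)"
        using pq(3)[of k] pq'(3)[of k] by (simp add: add_frac_eq)
      then show ?thesis using pq(4)[of k] pq'(4)[of k] assms by (simp add: abs_le_iff)
    qed
  qed (use assms in simp)
qed

lemma recursive_real_diff_nonneg:
  assumes "recursive_real x" "recursive_real y" "0 \<le> y" "y \<le> x"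
  shows "recursive_real (x - y)"
proof -
  obtain p q where pq: "loop_computable (\<lambda>e. p (e 0))" "loop_computable (\<lambda>e. q (e 0))"
    "\<And>k. 0 < q k" "\<And>k. \<bar>\<bar>x\<bar> - real (p k) / real (q k)\<bar> \<le> 1 / 2 ^ (k + 0)"
    using recursive_realE[OF assms(1)] by blast
  obtain p' q' where pq': "loop_computable (\<lambda>e. p' (e 0))" "loop_computable (\<lambda>e. q' (e 0))"
    "\<And>k. 0 < q' k" "\<And>k. \<bar>\<bar>y\<bar> - real (p' k) / real (q' k)\<bar> \<le> 1 / 2 ^ (k + 0)"
    using recursive_realE[OF assms(2)] by blast
  show ?thesis
  proof (rule recursive_realI[where c = 2])
    show "loop_computable (\<lambda>e. p (e 0) * q' (e 0) - p' (e 0) * q (e 0))"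
      "loop_computable (\<lambda>e. q (e 0) * q' (e 0))"
      by (intro loop_computable_intros pq pq')+
    show "0 < q k * q' k" for k using pq pq' by simp
    show "\<bar>x - y - real (p k * q' k - p' k * q k) / real (q k * q' k)\<bar> \<le> 2 / 2 ^ k" for k
    proof -
      have q: "0 < q k" "0 < q' k" using pq pq' by auto
      \<comment> \<open>Truncated subtraction clips the approximation at \<open>0\<close>, which
        cannot increase the error as \<open>x - y\<close> is nonnegative.\<close>
      have "real (p k * q' k - p' k * q k) = max 0 (real (p k) * q' k - real (p' k) * q k)"
        by (cases "p' k * q k \<le> p k * q' k")
          (auto simp: of_nat_diff max_def simp flip: of_nat_mult)
      also have "\<dots> / real (q k * q' k) =
          max 0 ((real (p k) * q' k - real (p' k) * q k) / real (q k * q' k))"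
        using q by (auto simp: max_def divide_le_0_iff zero_le_divide_iff mult_le_0_iff)
      also have "(real (p k) * q' k - real (p' k) * q k) / real (q k * q' k) =
          real (p k) / real (q k) - real (p' k) / real (q' k)"
        using q by (simp add: diff_frac_eq)
      finally show ?thesis using pq(4)[of k] pq'(4)[of k] assms by (simp add: abs_le_iff max_def)
    qed
  qed (use assms in simp)
qed

lemma recursive_real_diff_abs:
  assumes "recursive_real x" "recursive_real y"
  shows "recursive_real (\<bar>x\<bar> - \<bar>y\<bar>)"
proof (cases "\<bar>y\<bar> \<le> \<bar>x\<bar>")
  case True
  then show ?thesis using assms by (intro recursive_real_diff_nonneg) (auto simp: recursive_real_abs_iff)
next
  case False
  then have "recursive_real (\<bar>y\<bar> - \<bar>x\<bar>)"
    using assms by (intro recursive_real_diff_nonneg) (auto simp: recursive_real_abs_iff)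
  then show ?thesis using recursive_real_minus_iff[of "\<bar>y\<bar> - \<bar>x\<bar>"] by simp
qed

lemma recursive_real_add:
  assumes "recursive_real x" "recursive_real y"
  shows "recursive_real (x + y)"
proof -
  have sum: "recursive_real (\<bar>x\<bar> + \<bar>y\<bar>)"
    using assms by (intro recursive_real_add_nonneg) (auto simp: recursive_real_abs_iff)
  note diff = recursive_real_diff_abs[OF assms]
  have "\<bar>x + y\<bar> = \<bar>\<bar>x\<bar> + \<bar>y\<bar>\<bar> \<or> \<bar>x + y\<bar> = \<bar>\<bar>x\<bar> - \<bar>y\<bar>\<bar>" by linarith
  then show ?thesis using sum diff recursive_real_abs_iff by metis
qed

lemma recursive_real_diff: "recursive_real x \<Longrightarrow> recursive_real y \<Longrightarrow> recursive_real (x - y)"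
  using recursive_real_add[of x "- y"] by (simp add: recursive_real_minus_iff)

lemma recursive_real_mult:
  assumes "recursive_real x" "recursive_real y"
  shows "recursive_real (x * y)"
proof -
  obtain p q where pq: "loop_computable (\<lambda>e. p (e 0))" "loop_computable (\<lambda>e. q (e 0))"
    "\<And>k. 0 < q k" "\<And>k. \<bar>\<bar>x\<bar> - real (p k) / real (q k)\<bar> \<le> 1 / 2 ^ (k + 0)"
    using recursive_realE[OF assms(1)] by blast
  obtain p' q' where pq': "loop_computable (\<lambda>e. p' (e 0))" "loop_computable (\<lambda>e. q' (e 0))"
    "\<And>k. 0 < q' k" "\<And>k. \<bar>\<bar>y\<bar> - real (p' k) / real (q' k)\<bar> \<le> 1 / 2 ^ (k + 0)"
    using recursive_realE[OF assms(2)] by blast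
  have "recursive_real (\<bar>x\<bar> * \<bar>y\<bar>)"
  \<comment> \<open>The error is at most \<open>\<bar>x\<bar> * \<epsilon> + b * \<epsilon>\<close>
    with the approximation \<open>b\<close> of \<open>\<bar>y\<bar>\<close> bounded by
    \<open>\<bar>y\<bar> + 1\<close>.\<close>
  proof (rule recursive_realI[where c = "\<bar>x\<bar> + \<bar>y\<bar> + 1"])
    show "loop_computable (\<lambda>e. p (e 0) * p' (e 0))" "loop_computable (\<lambda>e. q (e 0) * q' (e 0))"
      by (intro loop_computable_intros pq pq')+
    show "0 < q k * q' k" for k using pq pq' by simp
    show "\<bar>\<bar>x\<bar> * \<bar>y\<bar> - real (p k * p' k) / real (q k * q' k)\<bar> \<le> (\<bar>x\<bar> + \<bar>y\<bar> + 1) / 2 ^ k" for k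
    proof -
      define a b \<epsilon> where "a = real (p k) / real (q k)" "b = real (p' k) / real (q' k)"
        "\<epsilon> = 1 / (2::real) ^ k"
      have *: "\<bar>\<bar>x\<bar> - a\<bar> \<le> \<epsilon>" "\<bar>\<bar>y\<bar> - b\<bar> \<le> \<epsilon>" "0 \<le> b"
        using pq(4)[of k] pq'(4)[of k] by (auto simp: a_b_\<epsilon>_def)
      have "\<epsilon> \<le> 1" by (simp add: a_b_\<epsilon>_def)
      then have b: "b \<le> \<bar>y\<bar> + 1" using * by linarith
      have "\<bar>x\<bar> * \<bar>y\<bar> - a * b = \<bar>x\<bar> * (\<bar>y\<bar> - b) + b * (\<bar>x\<bar> - a)" by (simp add: algebra_simps)
      then have "\<bar>\<bar>x\<bar> * \<bar>y\<bar> - a * b\<bar> \<le> \<bar>x\<bar> * \<bar>\<bar>y\<bar> - b\<bar> + b * \<bar>\<bar>x\<bar> - a\<bar>"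
        using *(3) by (metis abs_abs abs_mult abs_of_nonneg abs_triangle_ineq)
      also have "\<dots> \<le> \<bar>x\<bar> * \<epsilon> + (\<bar>y\<bar> + 1) * \<epsilon>"
        using * b by (intro add_mono mult_mono) auto
      also have "\<dots> = (\<bar>x\<bar> + \<bar>y\<bar> + 1) / 2 ^ k" by (simp add: a_b_\<epsilon>_def add_divide_distrib)
      finally show ?thesis by (simp add: a_b_\<epsilon>_def)
    qed
  qed simp
  then show ?thesis by (metis abs_mult recursive_real_abs_iff)
qed

text \<open>The fixed \<open>j\<close> keeps all approximations above
  \<open>\<bar>x\<bar> / 2\<close>, so numerator and denominator can be exchanged and the error
  grows by a constant factor only.\<close>

lemma recursive_real_inverse:
  assumes "recursive_real x"
  shows "recursive_real (inverse x)"
proof (cases "x = 0")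
  case True
  then show ?thesis using assms by simp
next
  case False
  let ?x = "\<bar>x\<bar>"
  obtain j where "(1 / 2) ^ j < ?x / 2" using real_arch_pow_inv[of "?x / 2" "1 / 2"] False by auto
  then have j: "1 / 2 ^ j < ?x / 2" by (simp add: power_one_over)
  obtain p q where pq: "loop_computable (\<lambda>e. p (e 0))" "loop_computable (\<lambda>e. q (e 0))"
    "\<And>k. 0 < q k" "\<And>k. \<bar>?x - real (p k) / real (q k)\<bar> \<le> 1 / 2 ^ (k + j)"
    using recursive_realE[OF assms] by blast
  have le: "1 / 2 ^ (k + j) \<le> 1 / (2::real) ^ j" "1 / 2 ^ (k + j) \<le> 1 / (2::real) ^ k" for k
    by (simp_all add: field_simps power_add)
  have big: "?x / 2 < real (p k) / real (q k)" for k
    using pq(4)[of k] le(1)[of k] j by linarith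
  have "recursive_real (inverse ?x)"
  proof (rule recursive_realI[OF pq(2,1), where c = "2 / ?x\<^sup>2"])
    show p: "0 < p k" for k using big[of k] False by (cases "p k = 0") auto
    show "\<bar>inverse ?x - real (q k) / real (p k)\<bar> \<le> 2 / ?x\<^sup>2 / 2 ^ k" for k
    proof -
      define a where "a = real (p k) / real (q k)"
      have a: "?x / 2 < a" using big[of k] by (simp add: a_def)
      then have "0 < a" using False by linarith
      have "inverse ?x - real (q k) / real (p k) = (a - ?x) / (?x * a)"
        using p[of k] pq(3)[of k] False by (simp add: a_def field_simps)
      then have "\<bar>inverse ?x - real (q k) / real (p k)\<bar> = \<bar>?x - a\<bar> / (?x * a)"
        using \<open>0 < a\<close> by (simp add: abs_mult abs_minus_commute)
      also have "\<dots> \<le> (1 / 2 ^ k) / (?x * (?x / 2))"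
        using a False pq(4)[of k] le(2)[of k] by (intro frac_le mult_left_mono mult_pos_pos) (auto simp: a_def)
      also have "\<dots> = 2 / ?x\<^sup>2 / 2 ^ k" by (simp add: power2_eq_square)
      finally show ?thesis .
    qed
  qed simp
  then show ?thesis by (metis abs_inverse recursive_real_abs_iff)
qed

lemma recursive_real_divide: "recursive_real x \<Longrightarrow> recursive_real y \<Longrightarrow> recursive_real (x / y)"
  by (simp add: divide_inverse recursive_real_mult recursive_real_inverse)

lemma recursive_real_power: "recursive_real x \<Longrightarrow> recursive_real (x ^ n)"
  by (induction n) (auto intro: recursive_real_mult recursive_real_one)


section \<open>Power series and elementary functions\<close>

text \<open>The first \<open>n\<close> terms are put over the common denominator
  \<open>Q ^ n * V n\<close>, with \<open>V n\<close> the product of the first \<open>n\<close>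
  values of \<open>v\<close>; \<open>S\<close> is the recursion for the resulting numerator.\<close>

lemma loop_computable_partial_sum:
  assumes p: "loop_computable (\<lambda>e. p (e 0))" and q: "loop_computable (\<lambda>e. q (e 0))"
    and v: "loop_computable (\<lambda>e. v (e 0))" and N: "loop_computable (\<lambda>e. N (e 0))"
    and pos: "\<And>k. 0 < q k" "\<And>n. 0 < v n"
  obtains a d where "loop_computable (\<lambda>e. a (e 0))" "loop_computable (\<lambda>e. d (e 0))"
    "\<And>k. 0 < d k"
    "\<And>k. real (a k) / real (d k) = (\<Sum>n<N k. (real (p k) / real (q k)) ^ n / real (v n))"
proof
  define V where "V = (\<lambda>n. \<Prod>i<n. v i)"
  have V: "loop_computable (\<lambda>e. V (e 0))"
    unfolding V_def by (intro loop_computable_prod v loop_computable_var)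
  define S where "S P Q = rec_nat 0 (\<lambda>n r. r * Q * v n + P ^ n * Q * V n)" for P Q
  have p': "loop_computable (\<lambda>e. p (e i))" and q': "loop_computable (\<lambda>e. q (e i))" for i
    by (rule loop_computable_compose[OF p] loop_computable_compose[OF q], rule loop_computable_var)+
  show "loop_computable (\<lambda>e. S (p (e 0)) (q (e 0)) (N (e 0)))"
    unfolding S_def
    by (intro loop_computable_rec loop_computable_intros N p' q' v V)
  show "loop_computable (\<lambda>e. q (e 0) ^ N (e 0) * V (N (e 0)))"
    by (intro loop_computable_intros q N loop_computable_compose[OF V])
  have Vpos: "0 < V n" for n using pos by (auto simp: V_def)
  then show "0 < q k ^ N k * V (N k)" for k using pos by simp
  have "real (S P Q n) / real (Q ^ n * V n) = (\<Sum>i<n. (real P / real Q) ^ i / real (v i))"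
    if "0 < Q" for P Q n
  proof (induction n)
    case (Suc n)
    have "V (Suc n) = V n * v n" by (simp add: V_def)
    then have "real (S P Q (Suc n)) / real (Q ^ Suc n * V (Suc n)) =
        real (S P Q n) / real (Q ^ n * V n) + (real P / real Q) ^ n / real (v n)"
      using that Vpos[of n] pos(2)[of n] by (simp add: S_def field_simps power_divide)
    then show ?case using Suc by simp
  qed (simp add: S_def)
  then show "real (S (p k) (q k) (N k)) / real (q k ^ N k * V (N k)) =
      (\<Sum>n<N k. (real (p k) / real (q k)) ^ n / real (v n))" for k
    using pos by blast
qed

text \<open>With nonnegative coefficients the derivative is nonnegative and increasing on
  \<open>{0..Z}\<close>, so its value at \<open>Z\<close> is a Lipschitz constant; it converges
  because \<open>Z < Y\<close>.\<close>

lemma powser_Lipschitz: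
  fixes a :: "nat \<Rightarrow> real"
  assumes "\<And>n. 0 \<le> a n" "summable (\<lambda>n. a n * Y ^ n)" "0 \<le> Z" "Z < Y"
  obtains L where "0 \<le> L" "\<And>x y. x \<in> {0..Z} \<Longrightarrow> y \<in> {0..Z} \<Longrightarrow>
    \<bar>(\<Sum>n. a n * x ^ n) - (\<Sum>n. a n * y ^ n)\<bar> \<le> L * \<bar>x - y\<bar>"
proof
  let ?f' = "\<lambda>x. \<Sum>n. diffs a n * x ^ n"
  have nn: "0 \<le> diffs a n" for n using assms(1) by (simp add: diffs_def)
  have sm: "summable (\<lambda>n. diffs a n * x ^ n)" if "x \<in> {0..Z}" for x
  proof (rule termdiff_converges[where K = Y])
    fix x :: real assume "norm x < Y"
    then show "summable (\<lambda>n. a n * x ^ n)" using powser_inside[OF assms(2), of x] by simp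
  qed (use that assms in auto)
  show "0 \<le> ?f' Z" using sm assms nn by (intro suminf_nonneg) auto
  show "\<bar>(\<Sum>n. a n * x ^ n) - (\<Sum>n. a n * y ^ n)\<bar> \<le> ?f' Z * \<bar>x - y\<bar>"
    if "x \<in> {0..Z}" "y \<in> {0..Z}" for x y
    unfolding real_norm_def[symmetric]
  proof (rule field_differentiable_bound[where S = "{0..Z}"])
    fix z assume z: "z \<in> {0..Z}"
    then show "((\<lambda>x. \<Sum>n. a n * x ^ n) has_field_derivative ?f' z) (at z within {0..Z})"
      using assms by (intro has_field_derivative_at_within[OF termdiffs_strong[OF assms(2)]]) auto
    have "0 \<le> ?f' z" using sm[OF z] z nn by (intro suminf_nonneg) auto
    moreover have "?f' z \<le> ?f' Z"
      using sm z assms nn by (intro suminf_le mult_left_mono power_mono) auto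
    ultimately show "norm (?f' z) \<le> ?f' Z" by simp
  qed (use that in auto)
qed

text \<open>Terms at \<open>Y\<close> are bounded by some \<open>M\<close>, hence terms on
  \<open>{0..Z}\<close> by \<open>M * t ^ n\<close> with \<open>t = Z / Y < 1\<close>. Choosing
  \<open>t ^ m < 1 / 2\<close> makes every block of \<open>m\<close> terms worth one binary
  digit.\<close>

lemma powser_tail:
  fixes a :: "nat \<Rightarrow> real"
  assumes "\<And>n. 0 \<le> a n" "summable (\<lambda>n. a n * Y ^ n)" "0 \<le> Z" "Z < Y"
  obtains B m where "\<And>x k. x \<in> {0..Z} \<Longrightarrow>
    \<bar>(\<Sum>n. a n * x ^ n) - (\<Sum>n<m * k. a n * x ^ n)\<bar> \<le> B / 2 ^ k"
proof -
  define t where "t = Z / Y"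
  have t: "0 \<le> t" "t < 1" using assms by (auto simp: t_def)
  obtain M where M: "\<And>n. norm (a n * Y ^ n) \<le> M"
    using summable_imp_Bseq[OF assms(2)] by (auto simp: Bseq_def)
  then have "0 \<le> M" by (meson norm_ge_zero order_trans)
  obtain m where m: "t ^ m < 1 / 2" using real_arch_pow_inv[of "1 / 2" t] t by auto
  show ?thesis
  proof
    fix x k assume x: "x \<in> {0..Z}"
    have term_le: "a n * x ^ n \<le> M * t ^ n" for n
    proof -
      have "a n * x ^ n \<le> a n * Z ^ n" using x assms by (intro mult_left_mono power_mono) auto
      also have "\<dots> = (a n * Y ^ n) * t ^ n" using assms by (simp add: t_def power_divide)
      also have "\<dots> \<le> M * t ^ n" using M[of n] t by (intro mult_right_mono) auto
      finally show ?thesis .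
    qed
    have sm: "summable (\<lambda>n. a n * x ^ n)"
      using x assms powser_inside[OF assms(2), of x] by simp
    have "(\<Sum>n. a n * x ^ n) - (\<Sum>n<m * k. a n * x ^ n) = (\<Sum>n. a (n + m * k) * x ^ (n + m * k))"
      using suminf_minus_initial_segment[OF sm] by simp
    moreover have "0 \<le> (\<Sum>n. a (n + m * k) * x ^ (n + m * k))"
      using sm x assms by (intro suminf_nonneg) (auto simp: summable_iff_shift[of "\<lambda>n. a n * x ^ n"])
    moreover have "(\<Sum>n. a (n + m * k) * x ^ (n + m * k)) \<le> (\<Sum>n. M * t ^ (m * k) * t ^ n)"
    proof (rule suminf_le)
      show "a (n + m * k) * x ^ (n + m * k) \<le> M * t ^ (m * k) * t ^ n" for n
        using term_le[of "n + m * k"] by (simp add: power_add mult_ac)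
      show "summable (\<lambda>n. a (n + m * k) * x ^ (n + m * k))"
        using sm by (simp add: summable_iff_shift[of "\<lambda>n. a n * x ^ n"])
      show "summable (\<lambda>n. M * t ^ (m * k) * t ^ n)"
        using t by (intro summable_mult summable_geometric) auto
    qed
    moreover have "(\<Sum>n. M * t ^ (m * k) * t ^ n) = M * t ^ (m * k) * (1 / (1 - t))"
      using t by (subst suminf_mult) (auto simp: suminf_geometric summable_geometric)
    moreover have "M * t ^ (m * k) * (1 / (1 - t)) \<le> M * (1 / 2) ^ k * (1 / (1 - t))"
      using t m \<open>0 \<le> M\<close>
      by (intro mult_left_mono mult_right_mono) (auto simp: power_mult intro!: power_mono)
    ultimately show "\<bar>(\<Sum>n. a n * x ^ n) - (\<Sum>n<m * k. a n * x ^ n)\<bar> \<le> M / (1 - t) / 2 ^ k"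
      by (simp add: power_one_over field_simps)
  qed
qed

lemma recursive_real_powser:
  assumes "recursive_real x" "0 \<le> x" "x < Y"
    and v: "loop_computable (\<lambda>e. v (e 0))" "\<And>n. 0 < v n"
    and sm: "summable (\<lambda>n. Y ^ n / real (v n))"
  shows "recursive_real (\<Sum>n. x ^ n / real (v n))"
proof -
  define Z where "Z = (x + Y) / 2"
  have Z: "x < Z" "0 \<le> Z" "Z < Y" using assms by (auto simp: Z_def)
  define a where "a n = 1 / real (v n)" for n
  have a: "0 \<le> a n" "y ^ n / real (v n) = a n * y ^ n" for n y by (auto simp: a_def)
  have sm': "summable (\<lambda>n. a n * Y ^ n)" using sm by (simp add: a)
  obtain L where L: "0 \<le> L" "\<And>x y. x \<in> {0..Z} \<Longrightarrow> y \<in> {0..Z} \<Longrightarrow>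
      \<bar>(\<Sum>n. a n * x ^ n) - (\<Sum>n. a n * y ^ n)\<bar> \<le> L * \<bar>x - y\<bar>"
    using powser_Lipschitz[OF a(1) sm' Z(2,3)] by blast
  obtain B m where B: "\<And>x k. x \<in> {0..Z} \<Longrightarrow>
      \<bar>(\<Sum>n. a n * x ^ n) - (\<Sum>n<m * k. a n * x ^ n)\<bar> \<le> B / 2 ^ k"
    using powser_tail[OF a(1) sm' Z(2,3)] by blast
  \<comment> \<open>Approximations of \<open>x\<close> may exceed it; accuracy
    \<open>1 / 2 ^ j\<close> keeps them in \<open>{0..Z}\<close>, where both estimates hold.\<close>
  obtain j where "(1 / 2) ^ j < Z - x" using real_arch_pow_inv[of "Z - x" "1 / 2"] Z by auto
  then have j: "1 / 2 ^ j < Z - x" by (simp add: power_one_over)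
  obtain p q where pq: "loop_computable (\<lambda>e. p (e 0))" "loop_computable (\<lambda>e. q (e 0))"
    "\<And>k. 0 < q k" "\<And>k. \<bar>\<bar>x\<bar> - real (p k) / real (q k)\<bar> \<le> 1 / 2 ^ (k + j)"
    using recursive_realE[OF assms(1)] by blast
  have mk: "loop_computable (\<lambda>e. m * e 0)" by (intro loop_computable_intros)
  obtain b d where bd: "loop_computable (\<lambda>e. b (e 0))" "loop_computable (\<lambda>e. d (e 0))"
    "\<And>k. 0 < d k"
    "\<And>k. real (b k) / real (d k) = (\<Sum>n<m * k. (real (p k) / real (q k)) ^ n / real (v n))"
    using loop_computable_partial_sum[OF pq(1,2) v(1) mk pq(3) v(2)] by blast
  have "\<bar>(\<Sum>n. a n * x ^ n) - real (b k) / real (d k)\<bar> \<le> (L + B) / 2 ^ k" for k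
  proof -
    define r where "r = real (p k) / real (q k)"
    have le: "1 / 2 ^ (k + j) \<le> 1 / (2::real) ^ j" "1 / 2 ^ (k + j) \<le> 1 / (2::real) ^ k"
      by (simp_all add: field_simps power_add)
    have xr: "\<bar>x - r\<bar> \<le> 1 / 2 ^ (k + j)" using pq(4)[of k] assms by (simp add: r_def)
    moreover have "0 \<le> r" by (simp add: r_def)
    ultimately have r: "r \<in> {0..Z}" using le(1) j by auto
    have "\<bar>(\<Sum>n. a n * x ^ n) - (\<Sum>n. a n * r ^ n)\<bar> \<le> L * (1 / 2 ^ k)"
      using L(2)[of x r] r Z assms xr le(2) mult_left_mono[OF _ L(1), of "\<bar>x - r\<bar>" "1 / 2 ^ k"]
      by fastforce
    moreover have "\<bar>(\<Sum>n. a n * r ^ n) - real (b k) / real (d k)\<bar> \<le> B / 2 ^ k"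
      using B[OF r, of k] by (simp add: bd(4) a(2) flip: r_def)
    ultimately show ?thesis by (simp add: add_divide_distrib)
  qed
  moreover have "0 \<le> (\<Sum>n. a n * x ^ n)"
    using powser_inside[OF sm', of x] assms a by (intro suminf_nonneg) auto
  ultimately have "recursive_real (\<Sum>n. a n * x ^ n)"
    using bd by (intro recursive_realI[of b d]) auto
  then show ?thesis by (simp add: a(2))
qed

lemma recursive_real_alternating_powser:
  assumes "recursive_real x" "0 \<le> x" "x < Y"
    and v: "loop_computable (\<lambda>e. v (e 0))" "\<And>n. 0 < v n"
    and sm: "summable (\<lambda>n. Y ^ n / real (v n))"
  shows "recursive_real (\<Sum>n. (- 1) ^ n * (x ^ n / real (v n)))"
proof -
  let ?f = "\<lambda>n. (- 1) ^ n * (x ^ n / real (v n))"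
  let ?E = "\<lambda>n. (x\<^sup>2) ^ n / real (v (2 * n))" and ?O = "\<lambda>n. (x\<^sup>2) ^ n / real (v (2 * n + 1))"
  have sm_even: "summable (\<lambda>n. (Y\<^sup>2) ^ n / real (v (2 * n)))"
    using summable_reindex[OF sm, of "\<lambda>n. 2 * n"] assms by (simp add: o_def power_mult inj_def)
  have "summable (\<lambda>n. Y ^ (2 * n + 1) / real (v (2 * n + 1)))"
    using summable_reindex[OF sm, of "\<lambda>n. 2 * n + 1"] assms by (simp add: o_def inj_def)
  \<comment> \<open>Dividing by \<open>Y\<close> turns the odd powers into powers of
    \<open>Y\<^sup>2\<close>.\<close>
  from summable_mult[OF this, of "1 / Y"]
  have sm_odd: "summable (\<lambda>n. (Y\<^sup>2) ^ n / real (v (2 * n + 1)))"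
    using assms by (simp add: power_mult)
  have lt: "x\<^sup>2 < Y\<^sup>2" using assms by (intro power_strict_mono) auto
  have v_even: "loop_computable (\<lambda>e. v (2 * e 0))" and v_odd: "loop_computable (\<lambda>e. v (2 * e 0 + 1))"
    by (intro loop_computable_compose[OF v(1)] loop_computable_intros)+
  have even: "recursive_real (suminf ?E)"
    using lt by (intro recursive_real_powser[OF _ _ _ v_even v(2) sm_even] recursive_real_power assms) auto
  have odd: "recursive_real (suminf ?O)"
    using lt by (intro recursive_real_powser[OF _ _ _ v_odd v(2) sm_odd] recursive_real_power assms) auto
  have smE: "summable ?E"
    using lt assms by (intro summable_comparison_test'[OF sm_even, of 0])
      (auto intro!: divide_right_mono power_mono)
  have smO: "summable ?O"
    using lt assms by (intro summable_comparison_test'[OF sm_odd, of 0])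
      (auto intro!: divide_right_mono power_mono)
  have "summable ?f"
    using assms by (intro summable_comparison_test'[OF sm, of 0])
      (auto simp: abs_mult intro!: divide_right_mono power_mono)
  then have "(\<lambda>n. sum ?f {n * 2..<n * 2 + 2}) sums suminf ?f"
    by (intro sums_group summable_sums) auto
  moreover have "sum ?f {n * 2..<n * 2 + 2} = ?E n - x * ?O n" for n
  proof -
    have "{n * 2..<n * 2 + 2} = {2 * n, Suc (2 * n)}" by auto
    then show ?thesis by (simp add: power_mult)
  qed
  ultimately have "(\<lambda>n. ?E n - x * ?O n) sums suminf ?f" by simp
  moreover have "(\<lambda>n. ?E n - x * ?O n) sums (suminf ?E - x * suminf ?O)"
    using smE smO by (intro sums_diff sums_mult summable_sums)
  ultimately have "suminf ?f = suminf ?E - x * suminf ?O" by (rule sums_unique2)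
  then show ?thesis
    using even odd assms(1) by (simp add: recursive_real_diff recursive_real_mult)
qed

section \<open>Real elementary functions\<close>

lemma recursive_real_exp:
  assumes "recursive_real x"
  shows "recursive_real (exp x)"
proof -
  have "recursive_real (exp \<bar>x\<bar>)"
  proof -
    have exp: "exp y = (\<Sum>n. y ^ n / real (fact n))" "summable (\<lambda>n. y ^ n / real (fact n))" for y :: real
      using exp_converges[of y] by (auto simp: sums_iff divide_inverse mult.commute)
    show ?thesis unfolding exp(1)
      by (rule recursive_real_powser[where Y = "\<bar>x\<bar> + 1" and v = fact])
        (auto simp: assms recursive_real_abs_iff exp(2) simp del: of_nat_fact
          intro: loop_computable_intros)
  qed
  moreover have "exp x = exp \<bar>x\<bar> \<or> exp x = inverse (exp \<bar>x\<bar>)"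
    by (auto simp: abs_if exp_minus)
  ultimately show ?thesis using recursive_real_inverse by metis
qed

lemma summable_power_divide_fact_ge:
  assumes "\<And>n. n \<le> g n"
  shows "summable (\<lambda>n. (y::real) ^ n / real (fact (g n)))"
proof (rule summable_comparison_test'[of "\<lambda>n. \<bar>y\<bar> ^ n / fact n" 0])
  show "summable (\<lambda>n. \<bar>y\<bar> ^ n / fact n)"
    using exp_converges[of "\<bar>y\<bar>"] by (auto simp: sums_iff divide_inverse mult.commute)
  show "norm (y ^ n / real (fact (g n))) \<le> \<bar>y\<bar> ^ n / fact n" for n
    using fact_mono[OF assms[of n], where ?'a = real] by (auto simp: power_abs intro!: frac_le)
qed

lemma recursive_real_cos:
  assumes "recursive_real x"
  shows "recursive_real (cos x)"
proof -
  have "cos x = (\<Sum>n. (- 1) ^ n * ((x\<^sup>2) ^ n / real (fact (2 * n))))"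
    using cos_paired[of x] by (simp add: sums_iff power_mult)
  moreover have "recursive_real \<dots>"
    by (rule recursive_real_alternating_powser[where Y = "x\<^sup>2 + 1" and v = "\<lambda>n. fact (2 * n)"])
      (auto intro!: recursive_real_power assms loop_computable_intros summable_power_divide_fact_ge
        simp del: of_nat_fact)
  ultimately show ?thesis by simp
qed

lemma recursive_real_sin:
  assumes "recursive_real x"
  shows "recursive_real (sin x)"
proof -
  let ?f = "\<lambda>n. (- 1) ^ n * ((x\<^sup>2) ^ n / real (fact (2 * n + 1)))"
  have *: "recursive_real (suminf ?f)"
    by (rule recursive_real_alternating_powser[where Y = "x\<^sup>2 + 1" and v = "\<lambda>n. fact (2 * n + 1)"])
      (auto intro!: recursive_real_power assms loop_computable_intros summable_power_divide_fact_ge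
        simp del: of_nat_fact fact_Suc)
  have sm: "summable ?f"
    by (rule summable_comparison_test'[OF summable_power_divide_fact_ge[of "\<lambda>n. 2 * n + 1" "x\<^sup>2"], of 0])
      (auto simp: abs_mult simp del: fact_Suc)
  have "(- 1) ^ n / fact (2 * n + 1) * x ^ (2 * n + 1) = x * ?f n" for n
    by (simp add: power_mult del: fact_Suc)
  then have "(\<lambda>n. x * ?f n) sums sin x" using sin_paired[of x] by simp
  then have "sin x = x * suminf ?f"
    using sums_mult[OF summable_sums[OF sm], of x] sums_unique2 by blast
  then show ?thesis using * assms by (simp add: recursive_real_mult)
qed

lemma summable_power_divide_ge:
  assumes "0 \<le> y" "y < 1" "\<And>n. 0 < g n"
  shows "summable (\<lambda>n. (y::real) ^ n / real (g n))"
proof (rule summable_comparison_test'[of "\<lambda>n. y ^ n" 0])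
  show "summable (\<lambda>n. y ^ n)" using assms by (simp add: summable_geometric)
  show "norm (y ^ n / real (g n)) \<le> y ^ n" for n
  proof -
    have "y ^ n * 1 \<le> y ^ n * real (g n)"
      using assms(1) assms(3)[of n] by (intro mult_left_mono) (auto simp: Suc_le_eq)
    then show ?thesis using assms(1) assms(3)[of n] by (simp add: divide_le_eq)
  qed
qed

lemma recursive_real_minus_ln_one_minus:
  assumes "recursive_real x" "0 \<le> x" "x < 1"
  shows "recursive_real (- ln (1 - x))"
proof -
  let ?f = "\<lambda>n. x ^ n / real (n + 1)"
  have "recursive_real (suminf ?f)"
    by (rule recursive_real_powser[where Y = "(x + 1) / 2"])
      (use assms in \<open>auto intro!: loop_computable_intros summable_power_divide_ge simp del: of_nat_Suc\<close>)
  moreover have "- ln (1 - x) = x * suminf ?f"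
  proof -
    \<comment> \<open>\<open>ln_series\<close> expands in powers of its argument minus
      \<open>1\<close>, here \<open>- x\<close>; the two alternating signs cancel.\<close>
    have "(- 1) ^ n * (1 / real (n + 1)) * (1 - x - 1) ^ Suc n = - x * ?f n" for n
    proof -
      have "(- x) ^ n = (- 1) ^ n * x ^ n" by (rule power_minus)
      then have "(- 1) ^ n * (1 / real (n + 1)) * (1 - x - 1) ^ Suc n =
          ((- 1) ^ n * (- 1) ^ n) * (- x * ?f n)" by (simp only: power_Suc) simp
      also have "(- 1) ^ n * (- 1) ^ n = (1::real)" by (simp flip: power_mult_distrib)
      finally show ?thesis by simp
    qed
    then have "ln (1 - x) = (\<Sum>n. - x * ?f n)" using ln_series[of "1 - x"] assms by (simp only:)
    also have "\<dots> = - x * suminf ?f"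
      using assms by (intro suminf_mult summable_power_divide_ge) auto
    finally show ?thesis by simp
  qed
  ultimately show ?thesis using assms by (simp add: recursive_real_mult)
qed

text \<open>One of \<open>1 - x\<close> and \<open>1 - inverse x\<close> lies in the interval from
  \<open>0\<close> to below \<open>1\<close> that the series requires.\<close>

lemma recursive_real_ln:
  assumes "recursive_real x" "0 < x"
  shows "recursive_real (ln x)"
proof (cases "x \<le> 1")
  case True
  have "recursive_real (- ln (1 - (1 - x)))"
    using True assms
    by (intro recursive_real_minus_ln_one_minus recursive_real_diff recursive_real_one) auto
  then show ?thesis by (simp add: recursive_real_minus_iff)
next
  case False
  have "recursive_real (- ln (1 - (1 - inverse x)))"
    using False assms
    by (intro recursive_real_minus_ln_one_minus recursive_real_diff recursive_real_one
        recursive_real_inverse) (auto simp: field_simps)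
  then show ?thesis using assms by (simp add: ln_inverse)
qed

lemma recursive_real_arctan_small:
  assumes "recursive_real x" "\<bar>x\<bar> < 1"
  shows "recursive_real (arctan x)"
proof -
  let ?f = "\<lambda>n. (- 1) ^ n * ((x\<^sup>2) ^ n / real (2 * n + 1))"
  have x2: "x\<^sup>2 < 1" using assms(2) by (simp add: abs_square_less_1)
  have *: "recursive_real (suminf ?f)"
    by (rule recursive_real_alternating_powser[where Y = "(x\<^sup>2 + 1) / 2" and v = "\<lambda>n. 2 * n + 1"])
      (use x2 in \<open>auto intro!: recursive_real_power assms(1) loop_computable_intros
        summable_power_divide_ge simp del: of_nat_Suc of_nat_add\<close>)
  have sm: "summable ?f"
    by (rule summable_comparison_test'[OF summable_power_divide_ge[of "x\<^sup>2" "\<lambda>n. 2 * n + 1"], of 0])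
      (use x2 in \<open>auto simp: abs_mult\<close>)
  have "(- 1) ^ n * (1 / real (n * 2 + 1) * x ^ (n * 2 + 1)) = x * ?f n" for n
    by (simp add: power_mult mult.commute[of n])
  then have "arctan x = (\<Sum>n. x * ?f n)" using assms(2) by (simp add: arctan_series)
  then have "arctan x = x * suminf ?f" using suminf_mult[OF sm] by simp
  then show ?thesis using * assms by (simp add: recursive_real_mult)
qed

text \<open>The series for \<open>arctan 1\<close> would need some \<open>Y > 1\<close>, where it
  diverges; the arguments \<open>1 / 5\<close> and \<open>1 / 239\<close> lie inside the disc of
  convergence.\<close>

lemma recursive_real_pi: "recursive_real pi"
proof -
  have "recursive_real (4 * (4 * arctan (1 / 5) - arctan (1 / 239)))"
    by (intro recursive_real_mult recursive_real_diff recursive_real_arctan_small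
        recursive_real_divide recursive_real_one recursive_real_numeral) auto
  then show ?thesis by (simp flip: machin)
qed

text \<open>The reciprocal moves large arguments below \<open>1\<close>; the endpoint
  \<open>\<bar>x\<bar> = 1\<close> is settled by its known value \<open>pi / 4\<close>.\<close>

lemma recursive_real_arctan:
  assumes "recursive_real x"
  shows "recursive_real (arctan x)"
proof -
  consider "\<bar>x\<bar> < 1" | "\<bar>x\<bar> = 1" | "1 < \<bar>x\<bar>" by linarith
  then show ?thesis
  proof cases
    case 1
    with assms show ?thesis by (rule recursive_real_arctan_small)
  next
    case 2
    then have "\<bar>arctan x\<bar> = pi / 4" by (auto simp: abs_if arctan_minus arctan_one split: if_splits)
    then show ?thesis
      using recursive_real_divide[OF recursive_real_pi recursive_real_numeral, of "num.Bit0 (num.Bit0 num.One)"]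
        recursive_real_abs_iff by metis
  next
    case 3
    then have "arctan (1 / x) = sgn x * pi / 2 - arctan x" using Transcendental.arctan_inverse[of x] by auto
    then have "\<bar>arctan x\<bar> = \<bar>pi / 2 - arctan (1 / x)\<bar> \<or> \<bar>arctan x\<bar> = \<bar>pi / 2 + arctan (1 / x)\<bar>"
      using 3 by (auto simp: sgn_if split: if_splits)
    moreover have "recursive_real (arctan (1 / x))"
      using 3 assms by (intro recursive_real_arctan_small recursive_real_divide recursive_real_one)
        (auto simp: field_simps)
    moreover have "recursive_real (pi / 2)"
      by (intro recursive_real_divide recursive_real_pi recursive_real_numeral)
    ultimately show ?thesis
      using recursive_real_add recursive_real_diff recursive_real_abs_iff by metis
  qed
qed

section \<open>The complex logarithm and EML values\<close>

lemma recursive_real_Re_Ln: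
  assumes "recursive_real (Re z)" "recursive_real (Im z)" "z \<noteq> 0"
  shows "recursive_real (Re (Ln z))"
proof -
  have "0 < (Re z)\<^sup>2 + (Im z)\<^sup>2" using assms(3) by (simp add: complex_neq_0)
  \<comment> \<open>Halving the logarithm of the squared modulus avoids a square root.\<close>
  moreover from this have "Re (Ln z) = ln ((Re z)\<^sup>2 + (Im z)\<^sup>2) / 2"
    using assms(3) by (simp add: cmod_def ln_sqrt)
  ultimately show ?thesis
    using assms(1,2) by (simp only: recursive_real_divide recursive_real_ln recursive_real_add
        recursive_real_power recursive_real_numeral)
qed

text \<open>\<open>Im_Ln_eq\<close> distinguishes the signs of \<open>Re z\<close> and
  \<open>Im z\<close>; every branch is a recursive real, so it does not matter that no machine could
  find the right one.\<close>

lemma recursive_real_Im_Ln: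
  assumes "recursive_real (Re z)" "recursive_real (Im z)" "z \<noteq> 0"
  shows "recursive_real (Im (Ln z))"
proof -
  \<comment> \<open>For \<open>Re z = 0\<close> the quotient is \<open>0\<close> by convention, so
    no case split is needed here.\<close>
  have arctan: "recursive_real (arctan (Im z / Re z))"
    by (intro recursive_real_arctan recursive_real_divide assms)
  have pi2: "recursive_real (pi / 2)"
    by (intro recursive_real_divide recursive_real_pi recursive_real_numeral)
  then have "recursive_real (- pi / 2)" using recursive_real_minus_iff[of "pi / 2"] by simp
  then show ?thesis unfolding Im_Ln_eq[OF assms(3)]
    using arctan pi2 recursive_real_add[OF arctan recursive_real_pi]
      recursive_real_diff[OF arctan recursive_real_pi] by auto
qed

lemma recursive_real_eml_value:
  assumes "eml_has_value \<phi> z"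
  shows "recursive_real (Re z) \<and> recursive_real (Im z)"
  using assms
proof induction
  case one
  show ?case using recursive_real_of_nat[of 0] by (simp add: recursive_real_one)
next
  case (E \<alpha> a \<beta> b)
  then show ?case
    \<comment> \<open>\<open>Re_Ln\<close> would rewrite the real part to
      \<open>ln (cmod b)\<close>, to which \<open>recursive_real_Re_Ln\<close> no longer
      applies.\<close>
    by (auto simp: Re_exp Im_exp simp del: Re_Ln intro!: recursive_real_diff recursive_real_mult
        recursive_real_exp recursive_real_cos recursive_real_sin recursive_real_Re_Ln recursive_real_Im_Ln)
qed

lemma computable_complex_eml_value:
  "eml_defined \<phi> \<Longrightarrow> computable_complex (eml_value \<phi>)"
  unfolding computable_complex_def
  using recursive_real_eml_value[OF eml_has_value_value] recursive_real_imp_computable_real by blast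

theorem mainTheorem5:
  shows "(\<forall>\<phi> \<in> eml_expressions. eml_defined \<phi> \<longrightarrow> computable_complex (eml_value \<phi>)) \<and>
         EML_real \<subseteq> {x. computable_real x}"
proof (intro conjI ballI impI subsetI CollectI)
  fix x assume "x \<in> EML_real"
  then obtain \<phi> where "eml_defined \<phi>" "eml_value \<phi> = complex_of_real x"
    by (auto simp: EML_real_def EML_def)
  then have "computable_complex (complex_of_real x)" using computable_complex_eml_value by metis
  then show "computable_real x" by (simp add: computable_complex_def)
qed (rule computable_complex_eml_value)

end
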